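(* Let $(e_i)$ be a right dominant normalized basic sequence which dominates all of its normalized block bases, and let $J(e_i)$ be as in the context. Then the following are equivalent: (a) for every closed subspace $E$ of $J(e_i)$, every bounded linear operator from $E$ into $J(e_i)'$ is compact; (b) the sequence $(e_i)$ does not dominate $(e_i')$, where $(e_i')$ is the sequence of biorthogonal functionals of $(e_i)$ in $[e_i]'$.
   Context: A basic sequence $(x_i)$ is right dominant if it is unconditional and there is a constant $D$ such that whenever $1\le m(1)\le n(1)<m(2)\le n(2)<\dots$ and $(a_{n(i)})$ is finitely nonzero, $\|\sum a_{n(i)}x_{m(i)}\|\le D\|\sum a_{n(i)}x_{n(i)}\|$. A sequence $(x_i)$ dominates $(y_i)$ if there is $C$ with $\|\sum a_iy_i\|\le C\|\sum a_ix_i\|$ for all finitely nonzero real $(a_i)$. $[e_i]$ is the closed linear span of $(e_i)$. For finitely nonzero real $(a_i)$ define \[\Big\|\sum a_iu_i\Big\|=\sup\Big\{\Big\|\sum_{i=1}^k\Big(\sum_{j=p(i)}^{p(i+1)-1}a_j\Big)e_{p(i)}\Big\| : k\in\mathbb N,\ 1=p(1)<p(2)<\dots<p(k+1)\Big\},\] and let $J(e_i)$ be the completion of the span of the formal vectors $(u_i)$ under this norm. *)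

theory Defs
  imports "HOL-Analysis.Analysis"
begin

definition clspan :: "(nat \<Rightarrow> 'a::real_normed_vector) \<Rightarrow> 'a set" where
  "clspan e = closure (span (range e))"

definition basic_seq :: "(nat \<Rightarrow> 'a::real_normed_vector) \<Rightarrow> bool" where
  "basic_seq e \<longleftrightarrow>
     (\<forall>x \<in> clspan e. \<exists>!a::nat \<Rightarrow> real. (\<lambda>n. \<Sum>i<n. a i *\<^sub>R e i) \<longlonglongrightarrow> x)"

definition unconditional_basic :: "(nat \<Rightarrow> 'a::real_normed_vector) \<Rightarrow> bool" where
  "unconditional_basic e \<longleftrightarrow> basic_seq e \<and>
     (\<forall>x \<in> clspan e. \<exists>a::nat \<Rightarrow> real. ((\<lambda>i. a i *\<^sub>R e i) has_sum x) UNIV)"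

text \<open>Right dominant (0-indexed; finitely nonzero coefficient families are
  those indexed by i < k).\<close>
definition right_dominant :: "(nat \<Rightarrow> 'a::real_normed_vector) \<Rightarrow> bool" where
  "right_dominant x \<longleftrightarrow> unconditional_basic x \<and>
     (\<exists>D. \<forall>(m::nat \<Rightarrow> nat) (n::nat \<Rightarrow> nat) (k::nat) (b::nat \<Rightarrow> real).
        (\<forall>i. m i \<le> n i \<and> n i < m (Suc i)) \<longrightarrow>
        norm (\<Sum>i<k. b i *\<^sub>R x (m i)) \<le> D * norm (\<Sum>i<k. b i *\<^sub>R x (n i)))"

definition dominates :: "(nat \<Rightarrow> 'a::real_normed_vector) \<Rightarrow> (nat \<Rightarrow> 'b::real_normed_vector) \<Rightarrow> bool" where
  "dominates x y \<longleftrightarrow> (\<exists>C. \<forall>(k::nat) (a::nat \<Rightarrow> real).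
      norm (\<Sum>i<k. a i *\<^sub>R y i) \<le> C * norm (\<Sum>i<k. a i *\<^sub>R x i))"

definition normalized_block_basis :: "(nat \<Rightarrow> 'a::real_normed_vector) \<Rightarrow> (nat \<Rightarrow> 'a) \<Rightarrow> bool" where
  "normalized_block_basis e y \<longleftrightarrow>
     (\<exists>(p::nat \<Rightarrow> nat) (c::nat \<Rightarrow> real). strict_mono p \<and>
        (\<forall>j. y j = (\<Sum>i\<in>{p j..<p (Suc j)}. c i *\<^sub>R e i))) \<and>
     (\<forall>j. norm (y j) = 1)"

definition biorth :: "(nat \<Rightarrow> 'a::real_normed_vector) \<Rightarrow> nat \<Rightarrow> 'a \<Rightarrow> real" where
  "biorth e i x = (THE a::nat \<Rightarrow> real. (\<lambda>n. \<Sum>j<n. a j *\<^sub>R e j) \<longlonglongrightarrow> x) i"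

definition subspace_dual_norm :: "'a::real_normed_vector set \<Rightarrow> ('a \<Rightarrow> real) \<Rightarrow> real" where
  "subspace_dual_norm S f = Sup {\<bar>f x\<bar> | x. x \<in> S \<and> norm x \<le> 1}"

definition dominates_biorth :: "(nat \<Rightarrow> 'a::real_normed_vector) \<Rightarrow> bool" where
  "dominates_biorth e \<longleftrightarrow> (\<exists>C. \<forall>(k::nat) (a::nat \<Rightarrow> real).
      subspace_dual_norm (clspan e) (\<lambda>x. \<Sum>i<k. a i * biorth e i x)
        \<le> C * norm (\<Sum>i<k. a i *\<^sub>R e i))"

text \<open>The J-norm of a finitely nonzero coefficient sequence a
  (0-indexed partitions 0 = p 0 < p 1 < ... ).\<close>
definition Jnorm :: "(nat \<Rightarrow> 'a::real_normed_vector) \<Rightarrow> (nat \<Rightarrow> real) \<Rightarrow> real" where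
  "Jnorm e a = Sup {norm (\<Sum>i<k. (\<Sum>j\<in>{p i..<p (Suc i)}. a j) *\<^sub>R e (p i)) | k p.
                     p 0 = 0 \<and> strict_mono (p::nat \<Rightarrow> nat)}"

text \<open>u : nat => 'j realises J(e_i): 'j is a Banach space, the span of u is dense,
  and the norm of finite combinations of u is the J-norm.  This characterises the
  completion up to isometric isomorphism.\<close>
definition is_J_space :: "(nat \<Rightarrow> 'a::real_normed_vector) \<Rightarrow> (nat \<Rightarrow> 'j::banach) \<Rightarrow> bool" where
  "is_J_space e u \<longleftrightarrow>
     (\<forall>(k::nat) (a::nat \<Rightarrow> real).
        norm (\<Sum>i<k. a i *\<^sub>R u i) = Jnorm e (\<lambda>i. if i < k then a i else 0)) \<and>
     closure (span (range u)) = UNIV"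

definition bounded_linear_on :: "'a::real_normed_vector set \<Rightarrow> ('a \<Rightarrow> 'b::real_normed_vector) \<Rightarrow> bool" where
  "bounded_linear_on E T \<longleftrightarrow>
     (\<forall>x\<in>E. \<forall>y\<in>E. T (x + y) = T x + T y) \<and>
     (\<forall>c x. x \<in> E \<longrightarrow> T (c *\<^sub>R x) = c *\<^sub>R T x) \<and>
     (\<exists>K. \<forall>x\<in>E. norm (T x) \<le> K * norm x)"

definition compact_operator_on :: "'a::real_normed_vector set \<Rightarrow> ('a \<Rightarrow> 'b::real_normed_vector) \<Rightarrow> bool" where
  "compact_operator_on E T \<longleftrightarrow> compact (closure (T ` (E \<inter> cball 0 1)))"

end

theory Submission
  imports Defs "HOL-Complex_Analysis.Great_Picard"
begin

text \<open>If \<open>e\<close> dominates its biorthogonal functionals, then \<open>u i \<mapsto> u' i\<close> (coordinate functionals)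
  extends to a bounded operator from \<open>J\<close> to its dual, because \<open>u\<close> dominates \<open>e\<close> and the functionals
  of \<open>e\<close> dominate those of \<open>u\<close>; it is not compact, since the images of the \<open>u i\<close> are separated.

  Conversely, call a block of \<open>u\<close> zero-sum if its coefficients add up to 0.  Bounded zero-sum block
  sequences of \<open>u\<close> are dominated by \<open>e\<close>: here right dominance and the domination of block bases
  enter.  By a gliding hump, every bounded sequence in \<open>J\<close> has differences that are close to such
  blocks; unless \<open>e\<close> is equivalent to the unit vectors of \<open>l1\<close>, such differences are weakly null.
  A noncompact operator \<open>T\<close> thus gives sequences \<open>v k\<close>, \<open>w k\<close>, both dominated by \<open>e\<close>, with
  \<open>T (v k) (w k) \<ge> \<delta>\<close>; averaging over signs yields
  \<open>\<Sum> \<bar>b k * c k\<bar> \<le> C * \<parallel>\<Sum> b k e k\<parallel> * \<parallel>\<Sum> c k e k\<parallel>\<close>, that is, \<open>e\<close> dominates its biorthogonal functionals.\<close>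

text \<open>The hypotheses come without constants. Unconditionality gives one convergent expansion
  per vector; Baire's theorem turns this into the constant \<open>K\<close>. Domination of block
  bases allows a constant for each block basis, whereas the J-norm is a supremum over partitions,
  and each partition cuts a different block sequence out of the same vector. A gluing argument
  therefore provides one constant for all block sequences supported in the same intervals.
  Differences are taken because boundedness only yields subsequences along which every coordinate
  functional and the sum functional converge. Differences send these limits to 0, and the sum
  functional is what allows the approximating blocks to be zero-sum. The vectors norming
  \<open>T (v k)\<close> need not be of this kind, so they too are replaced by differences; the
  pairing stays large because a far \<open>v\<close> almost annihilates an earlier norming vector,
  and this is where weak nullness enters. The case of \<open>l1\<close> agrees with the theorem:
  there \<open>e\<close> dominates its biorthogonal functionals because these are bounded.\<close>

section \<open>Unconditional bases\<close>

text \<open>Baire's theorem in the subspace topology of \<open>S\<close>, which is completely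
  metrizable because \<open>S\<close> is closed. The sets \<open>F n\<close> are not assumed closed,
  so the ball is only found in a closure; the applications must then work with
  approximations.\<close>

lemma closed_subset_UN_closure_has_ball:
  fixes S :: "'a::banach set" and F :: "nat \<Rightarrow> 'a set"
  assumes "closed S" "S \<noteq> {}" "S \<subseteq> (\<Union>n. F n)"
  obtains n x r where "x \<in> S" "r > 0" "S \<inter> ball x r \<subseteq> closure (F n)"
proof -
  let ?X = "top_of_set S"
  have cm: "completely_metrizable_space ?X"
    by (rule completely_metrizable_space_closedin[OF completely_metrizable_space_euclidean])
      (use assms(1) in simp)
  have "\<exists>n. ?X interior_of (S \<inter> closure (F n)) \<noteq> {}"
  proof (rule ccontr)
    assume "\<not> ?thesis"
    then have int: "?X interior_of (S \<inter> closure (F n)) = {}" for n by blast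
    have "?X interior_of \<Union>(range (\<lambda>n. S \<inter> closure (F n))) = {}"
    proof (intro Baire_category_alt disjI1 cm)
      fix T assume "T \<in> range (\<lambda>n. S \<inter> closure (F n))"
      then obtain n where "T = S \<inter> closure (F n)" by blast
      then show "closedin ?X T \<and> ?X interior_of T = {}" by (simp add: int closedin_closed_Int)
    qed simp
    moreover have "\<Union>(range (\<lambda>n. S \<inter> closure (F n))) = S"
    proof
      show "S \<subseteq> \<Union>(range (\<lambda>n. S \<inter> closure (F n)))"
      proof
        fix x assume "x \<in> S"
        then obtain n where "x \<in> F n" using assms(3) by blast
        then have "x \<in> closure (F n)" by (rule subsetD[OF closure_subset])
        with \<open>x \<in> S\<close> show "x \<in> \<Union>(range (\<lambda>n. S \<inter> closure (F n)))" by blast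
      qed
    qed auto
    ultimately have "?X interior_of S = {}" by simp
    then show False
      using assms(2) interior_of_topspace[of ?X] by simp
  qed
  then obtain n x where x: "x \<in> ?X interior_of (S \<inter> closure (F n))" by blast
  then obtain U where U: "openin ?X U" "x \<in> U" "U \<subseteq> S \<inter> closure (F n)"
    by (auto simp: interior_of_def)
  then obtain r where "r > 0" "ball x r \<inter> S \<subseteq> U"
    unfolding openin_contains_ball by blast
  then show thesis using that[of x r n] U by blast
qed

lemma clspan_closed: "closed (clspan e)"
  and clspan_subspace: "subspace (clspan e)"
  and clspan_base: "e i \<in> clspan e"
proof -
  show "closed (clspan e)" by (simp add: clspan_def)
  show "subspace (clspan e)"
    unfolding clspan_def
  proof (rule subspaceI)
    let ?S = "span (range e)"
    show "0 \<in> closure ?S" using closure_subset[of ?S] span_zero by blast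
  next
    fix x y :: 'a assume "x \<in> closure (span (range e))" "y \<in> closure (span (range e))"
    then obtain f g where f: "\<forall>n. f n \<in> span (range e)" "f \<longlonglongrightarrow> x"
      and g: "\<forall>n. g n \<in> span (range e)" "g \<longlonglongrightarrow> y" unfolding closure_sequential by auto
    have "\<forall>n. f n + g n \<in> span (range e)" using f(1) g(1) by (simp add: span_add)
    with tendsto_add[OF f(2) g(2)] show "x + y \<in> closure (span (range e))"
      unfolding closure_sequential by (intro exI[of _ "\<lambda>n. f n + g n"]) simp
  next
    fix c and x :: 'a assume "x \<in> closure (span (range e))"
    then obtain f where f: "\<forall>n. f n \<in> span (range e)" "f \<longlonglongrightarrow> x" unfolding closure_sequential by auto
    have "\<forall>n. c *\<^sub>R f n \<in> span (range e)" using f(1) by (simp add: span_mul)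
    with tendsto_scaleR[OF tendsto_const f(2)] show "c *\<^sub>R x \<in> closure (span (range e))"
      unfolding closure_sequential by (intro exI[of _ "\<lambda>n. c *\<^sub>R f n"]) simp
  qed
  have "e i \<in> span (range e)" by (intro span_base rangeI)
  then show "e i \<in> clspan e" unfolding clspan_def by (rule subsetD[OF closure_subset])
qed

text \<open>Finite sums over supersets of some finite \<open>G\<close> lie within 1 of
  \<open>x\<close>. Passing from \<open>F \<union> G\<close> back to \<open>F\<close> costs at most
  the sum of the norms over \<open>G\<close>.\<close>

lemma has_sum_bounded_partial_sums:
  fixes f :: "'i \<Rightarrow> 'a::real_normed_vector"
  assumes "(f has_sum x) UNIV"
  obtains B where "\<And>F. finite F \<Longrightarrow> norm (sum f F) \<le> B"
proof -
  have "(sum f \<longlongrightarrow> x) (finite_subsets_at_top UNIV)" using assms by (simp add: has_sum_def)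
  then have "\<forall>\<^sub>F F in finite_subsets_at_top UNIV. dist (sum f F) x < 1"
    by (rule tendstoD) simp
  then obtain G where G: "finite G" "\<And>F. finite F \<Longrightarrow> G \<subseteq> F \<Longrightarrow> dist (sum f F) x < 1"
    unfolding eventually_finite_subsets_at_top by auto
  have "norm (sum f F) \<le> norm x + 1 + (\<Sum>i\<in>G. norm (f i))" if "finite F" for F
  proof -
    have eq: "sum f F = sum f (F \<union> G) - sum f (G - F)"
      using sum.subset_diff[of F "F \<union> G" f] that G(1) by (simp add: Un_Diff)
    have "norm (sum f (F \<union> G)) \<le> norm x + 1"
      using G(2)[of "F \<union> G"] that G(1) norm_triangle_sub[of "sum f (F \<union> G)" x] by (simp add: dist_norm)
    moreover have "norm (sum f (G - F)) \<le> (\<Sum>i\<in>G. norm (f i))"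
      using G(1) by (intro order_trans[OF norm_sum] sum_mono2) auto
    ultimately show ?thesis unfolding eq
      by (rule order_trans[OF norm_triangle_ineq4 add_mono])
  qed
  then show thesis by (rule that)
qed

lemma has_sum_imp_LIMSEQ_lessThan:
  fixes f :: "nat \<Rightarrow> 'a::real_normed_vector"
  assumes "(f has_sum x) UNIV"
  shows "(\<lambda>n. \<Sum>i<n. f i) \<longlonglongrightarrow> x"
  using has_sum_imp_sums[OF assms] by (simp add: sums_def)

text \<open>The number \<open>r\<close> bounds all finite partial sums, not just the initial ones.
  It plays the role of an unconditional norm on coefficient sequences, the domain of the summation
  map in the open mapping argument.\<close>

definition expands :: "(nat \<Rightarrow> 'a::real_normed_vector) \<Rightarrow> (nat \<Rightarrow> real) \<Rightarrow> 'a \<Rightarrow> real \<Rightarrow> bool" where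
  "expands e a x r \<longleftrightarrow> (\<lambda>n. \<Sum>i<n. a i *\<^sub>R e i) \<longlonglongrightarrow> x \<and>
     (\<forall>F. finite F \<longrightarrow> norm (\<Sum>i\<in>F. a i *\<^sub>R e i) \<le> r)"

lemma expands_add:
  assumes "expands e a x r" "expands e b y s"
  shows "expands e (\<lambda>i. a i + b i) (x + y) (r + s)"
proof -
  have eq: "(\<Sum>i\<in>F. (a i + b i) *\<^sub>R e i) = (\<Sum>i\<in>F. a i *\<^sub>R e i) + (\<Sum>i\<in>F. b i *\<^sub>R e i)" for F
    by (simp add: scaleR_left_distrib sum.distrib)
  show ?thesis
    using assms unfolding expands_def eq
    by (intro conjI allI impI tendsto_add norm_triangle_mono) blast+
qed

lemma expands_scale:
  assumes "expands e a x r"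
  shows "expands e (\<lambda>i. c * a i) (c *\<^sub>R x) (\<bar>c\<bar> * r)"
proof -
  have eq: "(\<Sum>i\<in>F. (c * a i) *\<^sub>R e i) = c *\<^sub>R (\<Sum>i\<in>F. a i *\<^sub>R e i)" for F
    by (simp add: scaleR_right.sum)
  show ?thesis
    using assms unfolding expands_def eq norm_scaleR
    by (intro conjI allI impI tendsto_scaleR tendsto_const mult_left_mono) simp_all
qed

lemma expands_uminus:
  assumes "expands e a x r"
  shows "expands e (\<lambda>i. - a i) (- x) r"
  using expands_scale[OF assms, of "-1"] by (simp del: scaleR_minus_left add: scaleR_minus1_left)

lemma expands_clspan: "expands e a x r \<Longrightarrow> x \<in> clspan e"
proof -
  assume a: "expands e a x r"
  have "(\<Sum>i<n. a i *\<^sub>R e i) \<in> clspan e" for n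
    by (intro subspace_sum clspan_subspace subspace_mul clspan_base)
  moreover have "(\<lambda>n. \<Sum>i<n. a i *\<^sub>R e i) \<longlonglongrightarrow> x" using a by (simp add: expands_def)
  ultimately show ?thesis
    using closed_sequentially[OF clspan_closed, of "\<lambda>n. \<Sum>i<n. a i *\<^sub>R e i" e x] by simp
qed

lemma expands_zero: "expands e (\<lambda>i. 0) 0 0"
  by (simp add: expands_def)

text \<open>The approximate solutions supplied by Baire's theorem are summed to exact ones, as in the
  proof of the open mapping theorem.\<close>
lemma expands_suminf:
  fixes e :: "nat \<Rightarrow> 'a::banach"
  assumes ne: "\<And>i. e i \<noteq> 0"
    and ex: "\<And>j. expands e (a j) (y j) (r * (1/2)^j)"
    and sums: "y sums x"
  shows "\<exists>b. expands e b x (2 * r)"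
proof -
  have geo: "summable (\<lambda>j. s * (1/2::real)^j)" for s
    by (intro summable_mult summable_geometric) simp
  have bd: "norm (\<Sum>i\<in>F. a j i *\<^sub>R e i) \<le> r * (1/2)^j" if "finite F" for F j
    using ex[of j] that unfolding expands_def by blast
  have lim: "(\<lambda>n. \<Sum>i<n. a j i *\<^sub>R e i) \<longlonglongrightarrow> y j" for j
    using ex[of j] unfolding expands_def by blast
  \<comment> \<open>Singletons \<open>F = {i}\<close> turn the bounds on partial sums into geometric
    bounds on the single coefficients.\<close>
  have abs: "summable (\<lambda>j. a j i)" for i
  proof (rule summable_comparison_test'[OF geo[of "r / norm (e i)"]])
    show "norm (a j i) \<le> r / norm (e i) * (1/2)^j" for j
      using bd[of "{i}" j] ne[of i] by (simp add: field_simps)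
  qed
  define b where "b i = (\<Sum>j. a j i)" for i
  have bF: "(\<lambda>j. \<Sum>i\<in>F. a j i *\<^sub>R e i) sums (\<Sum>i\<in>F. b i *\<^sub>R e i)" for F
    unfolding b_def by (intro sums_sum sums_scaleR_left summable_sums abs)
  have tail: "norm (\<Sum>j. \<Sum>i\<in>F. a (j + k) i *\<^sub>R e i) \<le> 2 * (r * (1/2)^k)" if "finite F" for F k
  proof -
    have "norm (\<Sum>j. \<Sum>i\<in>F. a (j + k) i *\<^sub>R e i) \<le> (\<Sum>j. r * (1/2)^k * (1/2)^j)"
    proof (rule norm_suminf_le[OF _ geo])
      show "norm (\<Sum>i\<in>F. a (j + k) i *\<^sub>R e i) \<le> r * (1/2)^k * (1/2)^j" for j
        using bd[OF that, of "j + k"] by (simp add: power_add mult_ac)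
    qed
    also have "\<dots> = 2 * (r * (1/2)^k)"
      by (subst suminf_mult) (simp_all add: suminf_geometric summable_geometric)
    finally show ?thesis .
  qed
  have nb: "norm (\<Sum>i\<in>F. b i *\<^sub>R e i) \<le> 2 * r" if "finite F" for F
    using tail[OF that, of 0] sums_unique[OF bF, of F] by simp
  have ytail: "norm (\<Sum>j. y (j + k)) \<le> 2 * (r * (1/2)^k)" for k
  proof -
    have ny: "norm (y j) \<le> r * (1/2)^j" for j
      by (rule LIMSEQ_le_const2[OF tendsto_norm[OF lim]]) (use bd in blast)
    have "norm (\<Sum>j. y (j + k)) \<le> (\<Sum>j. r * (1/2)^k * (1/2)^j)"
    proof (rule norm_suminf_le[OF _ geo])
      show "norm (y (j + k)) \<le> r * (1/2)^k * (1/2)^j" for j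
        using ny[of "j + k"] by (simp add: power_add mult_ac)
    qed
    also have "\<dots> = 2 * (r * (1/2)^k)"
      by (subst suminf_mult) (simp_all add: suminf_geometric summable_geometric)
    finally show ?thesis .
  qed
  have "(\<lambda>n. \<Sum>i<n. b i *\<^sub>R e i) \<longlonglongrightarrow> x"
  proof (rule LIMSEQ_I)
    fix \<epsilon> :: real assume \<epsilon>: "\<epsilon> > 0"
    \<comment> \<open>The tails beyond \<open>k\<close>, that of the partial sums and that of the
      vectors \<open>y j\<close>, contribute at most \<open>2 * r * (1/2)^k\<close> each. The
      finitely many remaining expansions converge.\<close>
    have "(\<lambda>k. 4 * r * (1/2)^k) \<longlonglongrightarrow> 4 * r * 0"
      by (intro tendsto_mult tendsto_const LIMSEQ_power_zero) simp
    from order_tendstoD(2)[OF this, of "\<epsilon>/2"] \<epsilon>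
    obtain k where k: "4 * r * (1/2)^k < \<epsilon>/2"
      by (auto simp: eventually_sequentially)
    have "(\<lambda>n. \<Sum>j<k. ((\<Sum>i<n. a j i *\<^sub>R e i) - y j)) \<longlonglongrightarrow> (\<Sum>j<k. y j - y j)"
      by (intro tendsto_sum tendsto_diff tendsto_const lim)
    then have "(\<lambda>n. \<Sum>j<k. ((\<Sum>i<n. a j i *\<^sub>R e i) - y j)) \<longlonglongrightarrow> 0" by simp
    from LIMSEQ_D[OF this, of "\<epsilon>/2"] \<epsilon> obtain n0 where
      n0: "\<And>n. n \<ge> n0 \<Longrightarrow> norm (\<Sum>j<k. ((\<Sum>i<n. a j i *\<^sub>R e i) - y j)) < \<epsilon>/2" by auto
    have "norm ((\<Sum>i<n. b i *\<^sub>R e i) - x) < \<epsilon>" if "n \<ge> n0" for n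
    proof -
      have 1: "(\<Sum>i<n. b i *\<^sub>R e i) = (\<Sum>j. \<Sum>i<n. a (j + k) i *\<^sub>R e i) + (\<Sum>j<k. \<Sum>i<n. a j i *\<^sub>R e i)"
        using suminf_split_initial_segment[OF sums_summable[OF bF[of "{..<n}"]], of k]
          sums_unique[OF bF[of "{..<n}"]] by simp
      have 2: "x = (\<Sum>j. y (j + k)) + (\<Sum>j<k. y j)"
        using suminf_split_initial_segment[OF sums_summable[OF sums], of k] sums_unique[OF sums] by simp
      have "(\<Sum>i<n. b i *\<^sub>R e i) - x = (\<Sum>j. \<Sum>i<n. a (j + k) i *\<^sub>R e i) - (\<Sum>j. y (j + k))
          + (\<Sum>j<k. ((\<Sum>i<n. a j i *\<^sub>R e i) - y j))"
        unfolding 1 2 by (simp add: sum_subtractf)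
      then have "norm ((\<Sum>i<n. b i *\<^sub>R e i) - x) \<le> norm (\<Sum>j. \<Sum>i<n. a (j + k) i *\<^sub>R e i) + norm (\<Sum>j. y (j + k))
          + norm (\<Sum>j<k. ((\<Sum>i<n. a j i *\<^sub>R e i) - y j))"
        by (simp only:) (rule norm_triangle_mono[OF norm_triangle_ineq4 order_refl])
      also have "\<dots> < \<epsilon>"
        using tail[of "{..<n}" k] ytail[of k] n0[OF that] k by simp
      finally show ?thesis .
    qed
    then show "\<exists>no. \<forall>n\<ge>no. norm ((\<Sum>i<n. b i *\<^sub>R e i) - x) < \<epsilon>" by blast
  qed
  then show ?thesis using nb unfolding expands_def by auto
qed

lemma ex1_unique: "\<exists>!a. P a \<Longrightarrow> P x \<Longrightarrow> P y \<Longrightarrow> x = y"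
  by metis

lemma basic_seq_nonzero:
  assumes "basic_seq e"
  shows "e i \<noteq> 0"
proof
  assume "e i = 0"
  have "0 \<in> clspan e" by (simp add: clspan_subspace subspace_0)
  with assms have "\<exists>!a::nat \<Rightarrow> real. (\<lambda>n. \<Sum>i<n. a i *\<^sub>R e i) \<longlonglongrightarrow> 0" by (simp add: basic_seq_def)
  moreover have "(\<lambda>n. \<Sum>j<n. (if j = i then 1 else 0::real) *\<^sub>R e j) \<longlonglongrightarrow> 0"
  proof -
    have "(if j = i then 1 else 0::real) *\<^sub>R e j = 0" for j using \<open>e i = 0\<close> by simp
    then show ?thesis by (simp only: sum.neutral_const) simp
  qed
  moreover have "(\<lambda>n. \<Sum>j<n. (0::real) *\<^sub>R e j) \<longlonglongrightarrow> 0" by simp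
  ultimately have "(\<lambda>j. if j = i then 1 else 0::real) = (\<lambda>j. 0)"
    by (rule ex1_unique[where P = "\<lambda>a. (\<lambda>n. \<Sum>j<n. a j *\<^sub>R e j) \<longlonglongrightarrow> 0"])
  then show False by (metis zero_neq_one)
qed

text \<open>Open mapping argument for the map from expansions to vectors: Baire makes the pointwise
  bounds uniform up to a small error, and iterating on the error removes it.\<close>

lemma unconditional_expansion_bound:
  fixes e :: "nat \<Rightarrow> 'a::banach"
  assumes unc: "unconditional_basic e"
  obtains K where "\<And>x. x \<in> clspan e \<Longrightarrow> \<exists>a. expands e a x (K * norm x)"
proof -
  have basic: "basic_seq e" using unc by (simp add: unconditional_basic_def)
  let ?A = "\<lambda>r. {x. \<exists>a. expands e a x r}"
  have cover: "clspan e \<subseteq> (\<Union>n. ?A (real n))"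
  proof
    fix x assume "x \<in> clspan e"
    then obtain a where a: "((\<lambda>i. a i *\<^sub>R e i) has_sum x) UNIV"
      using unc by (auto simp: unconditional_basic_def)
    obtain B where B: "\<And>F. finite F \<Longrightarrow> norm (\<Sum>i\<in>F. a i *\<^sub>R e i) \<le> B"
      using has_sum_bounded_partial_sums[OF a] by blast
    have "expands e a x (real (nat \<lceil>B\<rceil>))"
      unfolding expands_def
    proof (intro conjI allI impI)
      show "(\<lambda>n. \<Sum>i<n. a i *\<^sub>R e i) \<longlonglongrightarrow> x" by (rule has_sum_imp_LIMSEQ_lessThan[OF a])
      show "norm (\<Sum>i\<in>F. a i *\<^sub>R e i) \<le> real (nat \<lceil>B\<rceil>)" if "finite F" for F
        by (rule order_trans[OF B[OF that] real_nat_ceiling_ge])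
    qed
    then show "x \<in> (\<Union>n. ?A (real n))" by blast
  qed
  have ne: "clspan e \<noteq> {}" using clspan_base[of e 0] by auto
  obtain n x0 \<rho> where x0: "x0 \<in> clspan e" "\<rho> > 0" "clspan e \<inter> ball x0 \<rho> \<subseteq> closure (?A (real n))"
    by (rule closed_subset_UN_closure_has_ball[OF clspan_closed ne cover])
  \<comment> \<open>Half the difference of approximations to \<open>x0 + x\<close> and
    \<open>x0 - x\<close> moves the ball from \<open>x0\<close> to the origin without increasing the
    size \<open>n\<close>.\<close>
  have approx: "\<exists>y a. expands e a y (real n) \<and> norm (x - y) < \<eta>"
    if "x \<in> clspan e" "norm x < \<rho>" "\<eta> > 0" for x \<eta>
  proof -
    have "x0 + x \<in> closure (?A (real n))" "x0 - x \<in> closure (?A (real n))"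
      using that x0(1) subspace_add[OF clspan_subspace x0(1) that(1)] subspace_diff[OF clspan_subspace x0(1) that(1)]
      by (simp_all add: subsetD[OF x0(3)] dist_norm)
    then obtain y1 y2 where "y1 \<in> ?A (real n)" "dist y1 (x0 + x) < \<eta>"
        "y2 \<in> ?A (real n)" "dist y2 (x0 - x) < \<eta>"
      unfolding closure_approachable using \<open>\<eta> > 0\<close> by meson
    then obtain a1 a2 where y: "expands e a1 y1 (real n)" "dist y1 (x0 + x) < \<eta>"
        "expands e a2 y2 (real n)" "dist y2 (x0 - x) < \<eta>" by auto
    have "expands e (\<lambda>i. (1/2) * (a1 i + - a2 i)) ((1/2) *\<^sub>R (y1 + - y2)) (\<bar>1/2\<bar> * (real n + real n))"
      by (intro expands_scale expands_add expands_uminus y)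
    moreover have "norm (x - (1/2) *\<^sub>R (y1 + - y2)) < \<eta>"
    proof -
      have "x - (1/2) *\<^sub>R (y1 + - y2) = (1/2) *\<^sub>R ((y2 - (x0 - x)) - (y1 - (x0 + x)))"
        by (simp add: algebra_simps flip: scaleR_add_left)
      also have "norm \<dots> \<le> (1/2) * (norm (y2 - (x0 - x)) + norm (y1 - (x0 + x)))"
        unfolding norm_scaleR by (intro mult_mono norm_triangle_ineq4) auto
      finally show ?thesis using y by (simp add: dist_norm)
    qed
    ultimately show ?thesis by fastforce
  qed
  \<comment> \<open>A vector of norm at most \<open>s\<close> is scaled by
    \<open>\<rho> / (2 * s)\<close> to fit into the ball; undoing this multiplies the size
    \<open>n\<close> by \<open>2 * s / \<rho>\<close>.\<close>
  define c where "c = 2 * real n / \<rho>"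
  have step: "\<exists>y a. expands e a y (c * s) \<and> norm (x - y) \<le> s / 2"
    if "x \<in> clspan e" "norm x \<le> s" for x s
  proof (cases "s = 0")
    case True
    then show ?thesis using that expands_zero[of e] by force
  next
    case False
    with that have s: "s > 0" by (smt (verit) norm_ge_zero)
    define t where "t = \<rho> / (2 * s)"
    have t: "t > 0" using s x0 by (simp add: t_def)
    have "norm (t *\<^sub>R x) \<le> t * s" using t that by simp
    also have "\<dots> < \<rho>" using s x0(2) by (simp add: t_def)
    finally have small: "norm (t *\<^sub>R x) < \<rho>" .
    have "t *\<^sub>R x \<in> clspan e" using clspan_subspace that(1) by (rule subspace_mul)
    moreover have "t * s / 2 > 0" using s t by simp
    ultimately obtain y a where ya: "expands e a y (real n)" "norm (t *\<^sub>R x - y) < t * s / 2"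
      using approx[OF _ small] by blast
    have "expands e (\<lambda>i. (1/t) * a i) ((1/t) *\<^sub>R y) (c * s)"
      using expands_scale[OF ya(1), of "1/t"] t s x0(2)
      by (simp add: t_def c_def field_simps)
    moreover have "norm (x - (1/t) *\<^sub>R y) \<le> s / 2"
    proof -
      have "x - (1/t) *\<^sub>R y = (1/t) *\<^sub>R (t *\<^sub>R x - y)" using t by (simp add: scaleR_diff_right)
      then have "norm (x - (1/t) *\<^sub>R y) = norm (t *\<^sub>R x - y) / t" using t by simp
      also have "\<dots> \<le> (t * s / 2) / t" using ya(2) t by (intro divide_right_mono) auto
      finally show ?thesis using t by simp
    qed
    ultimately show ?thesis by blast
  qed
  have "\<exists>b. expands e b x (2 * c * norm x)" if x: "x \<in> clspan e" for x
  proof -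
    define P where "P k z \<longleftrightarrow> z \<in> clspan e \<and> norm z \<le> norm x * (1/2)^k" for k z
    \<comment> \<open>\<open>f k\<close> is what is left of \<open>x\<close> after \<open>k\<close>
      corrections. The corrections are summed by \<open>expands_suminf\<close>, hence the factor 2
      in \<open>2 * c\<close>.\<close>
    have "\<exists>f. \<forall>k. ((k = 0 \<longrightarrow> f k = x) \<and> P k (f k)) \<and> (\<exists>a. expands e a (f k - f (Suc k)) (c * (norm x * (1/2)^k)))"
    proof (rule dependent_nat_choice)
      show "\<exists>z. (0 = (0::nat) \<longrightarrow> z = x) \<and> P 0 z" using x by (auto simp: P_def)
      fix z k assume z: "(k = 0 \<longrightarrow> z = x) \<and> P k z"
      then obtain y a where ya: "expands e a y (c * (norm x * (1/2)^k))" "norm (z - y) \<le> norm x * (1/2)^k / 2"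
        using step[of z "norm x * (1/2)^k"] by (auto simp: P_def)
      have "P (Suc k) (z - y)"
        using z ya expands_clspan[OF ya(1)] by (auto simp: P_def intro: subspace_diff clspan_subspace)
      moreover have "expands e a (z - (z - y)) (c * (norm x * (1/2)^k))" using ya by simp
      ultimately show "\<exists>z'. ((Suc k = 0 \<longrightarrow> z' = x) \<and> P (Suc k) z') \<and>
          (\<exists>a. expands e a (z - z') (c * (norm x * (1/2)^k)))" by blast
    qed
    then obtain f where f: "f 0 = x" "\<And>k. P k (f k)"
        "\<And>k. \<exists>a. expands e a (f k - f (Suc k)) (c * (norm x * (1/2)^k))" by metis
    obtain a where a: "\<And>k. expands e (a k) (f k - f (Suc k)) (c * norm x * (1/2)^k)"
      using f(3) by (metis mult.assoc)
    have "f \<longlonglongrightarrow> 0"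
    proof (rule Lim_null_comparison)
      show "\<forall>\<^sub>F k in sequentially. norm (f k) \<le> norm x * (1/2)^k" using f(2) by (simp add: P_def)
      have "(\<lambda>k. norm x * (1/2)^k) \<longlonglongrightarrow> norm x * 0"
        by (intro tendsto_mult tendsto_const LIMSEQ_power_zero) simp
      then show "(\<lambda>k. norm x * (1/2)^k) \<longlonglongrightarrow> 0" by simp
    qed
    from telescope_sums'[OF this] have "(\<lambda>k. f k - f (Suc k)) sums x" by (simp add: f(1))
    then show ?thesis
      using expands_suminf[OF basic_seq_nonzero[OF basic] a] by (simp add: mult.assoc)
  qed
  then show thesis by (intro that[of "2 * c"])
qed

section \<open>Coefficient functionals and the unconditional constant\<close>

lemma biorth_eqI:
  assumes "basic_seq e" "x \<in> clspan e" "(\<lambda>n. \<Sum>i<n. a i *\<^sub>R e i) \<longlonglongrightarrow> x"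
  shows "biorth e i x = a i"
proof -
  have "\<exists>!a::nat \<Rightarrow> real. (\<lambda>n. \<Sum>i<n. a i *\<^sub>R e i) \<longlonglongrightarrow> x"
    using assms(1,2) unfolding basic_seq_def by (rule bspec)
  then have "(THE a::nat \<Rightarrow> real. (\<lambda>n. \<Sum>i<n. a i *\<^sub>R e i) \<longlonglongrightarrow> x) = a" using assms(3)
    by (rule the1_equality[where P = "\<lambda>a. (\<lambda>n. \<Sum>i<n. a i *\<^sub>R e i) \<longlonglongrightarrow> x"])
  then show ?thesis by (simp add: biorth_def)
qed

text \<open>By uniqueness of coefficients the bounded expansion just found is the one given by
  \<open>biorth\<close>. This \<open>K\<close> is an unconditional constant of \<open>e\<close>; it
  is taken at least 1 so that it can serve as a nonnegative factor everywhere.\<close>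

lemma biorth_bound:
  fixes e :: "nat \<Rightarrow> 'a::banach"
  assumes unc: "unconditional_basic e"
  obtains K where "K \<ge> 1"
    "\<And>x F. x \<in> clspan e \<Longrightarrow> finite F \<Longrightarrow> norm (\<Sum>i\<in>F. biorth e i x *\<^sub>R e i) \<le> K * norm x"
proof -
  have basic: "basic_seq e" using unc by (simp add: unconditional_basic_def)
  obtain K where K: "\<And>x. x \<in> clspan e \<Longrightarrow> \<exists>a. expands e a x (K * norm x)"
    using unconditional_expansion_bound[OF unc] by blast
  show thesis
  proof (rule that[of "max 1 K"])
    show "max 1 K \<ge> 1" by simp
    fix x and F :: "nat set" assume x: "x \<in> clspan e" "finite F"
    obtain a where a: "expands e a x (K * norm x)" using K x by blast
    then have "biorth e i x = a i" for i
      using biorth_eqI[OF basic x(1)] by (simp add: expands_def)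
    then have "norm (\<Sum>i\<in>F. biorth e i x *\<^sub>R e i) \<le> K * norm x"
      using a x(2) by (simp add: expands_def)
    also have "\<dots> \<le> max 1 K * norm x" by (intro mult_right_mono) auto
    finally show "norm (\<Sum>i\<in>F. biorth e i x *\<^sub>R e i) \<le> max 1 K * norm x" .
  qed
qed

lemma finite_combination_clspan: "(\<Sum>i\<in>G. a i *\<^sub>R e i) \<in> clspan e"
  by (intro subspace_sum clspan_subspace subspace_mul clspan_base)

lemma biorth_finite_combination:
  assumes "basic_seq e" "finite G"
  shows "biorth e i (\<Sum>j\<in>G. a j *\<^sub>R e j) = (if i \<in> G then a i else 0)"
proof (rule biorth_eqI[OF assms(1) finite_combination_clspan])
  obtain N where N: "G \<subseteq> {..<N}" using assms(2) finite_nat_iff_bounded by blast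
  have "(\<Sum>i<n. (if i \<in> G then a i else 0) *\<^sub>R e i) = (\<Sum>j\<in>G. a j *\<^sub>R e j)" if "n \<ge> N" for n
    by (rule sum.mono_neutral_cong_right) (use N that in auto)
  then show "(\<lambda>n. \<Sum>i<n. (if i \<in> G then a i else 0) *\<^sub>R e i) \<longlonglongrightarrow> (\<Sum>j\<in>G. a j *\<^sub>R e j)"
    by (intro tendsto_eventually) (auto simp: eventually_sequentially)
qed

section \<open>Block sequences\<close>

text \<open>A convex function on a cube is bounded by its values at the vertices. Each induction
  step writes one weight as a convex combination of 0 and 1; \<open>v\<close> carries the terms
  already decided.\<close>

lemma norm_weighted_sum_le:
  fixes x :: "'i \<Rightarrow> 'a::real_normed_vector"
  assumes "finite G" "\<And>F. F \<subseteq> G \<Longrightarrow> norm (v + sum x F) \<le> M"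
    "\<And>i. i \<in> G \<Longrightarrow> 0 \<le> c i \<and> c i \<le> 1"
  shows "norm (v + (\<Sum>i\<in>G. c i *\<^sub>R x i)) \<le> M"
  using assms
proof (induction G arbitrary: v rule: finite_induct)
  case empty
  show ?case using empty(1)[of "{}"] by simp
next
  case (insert j G)
  let ?S = "\<Sum>i\<in>G. c i *\<^sub>R x i"
  have c: "0 \<le> c j" "c j \<le> 1" using insert.prems(2)[of j] by auto
  have 1: "norm (v + ?S) \<le> M"
  proof (rule insert.IH)
    show "norm (v + sum x F) \<le> M" if "F \<subseteq> G" for F using insert.prems(1)[of F] that by blast
  qed (use insert.prems(2) in blast)
  have 2: "norm ((v + x j) + ?S) \<le> M"
  proof (rule insert.IH)
    fix F assume F: "F \<subseteq> G"
    then have "sum x (insert j F) = x j + sum x F"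
      using insert.hyps by (intro sum.insert) (auto intro: finite_subset)
    then show "norm ((v + x j) + sum x F) \<le> M"
      using insert.prems(1)[of "insert j F"] F by (auto simp: add.assoc)
  qed (use insert.prems(2) in blast)
  have "v + (\<Sum>i\<in>insert j G. c i *\<^sub>R x i) = (1 - c j) *\<^sub>R (v + ?S) + c j *\<^sub>R ((v + x j) + ?S)"
    using insert.hyps by (simp add: algebra_simps)
  also have "norm \<dots> \<le> (1 - c j) * norm (v + ?S) + c j * norm ((v + x j) + ?S)"
    by (rule order_trans[OF norm_triangle_ineq]) (use c in simp)
  also have "\<dots> \<le> (1 - c j) * M + c j * M"
    using c 1 2 by (intro add_mono mult_left_mono) auto
  finally show ?case by (simp add: algebra_simps)
qed

lemma span_image_finite_sum:
  assumes "finite I" "x \<in> span (e ` I)"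
  obtains c where "x = (\<Sum>i\<in>I. c i *\<^sub>R e i)"
proof -
  have "\<exists>c. x = (\<Sum>i\<in>I. c i *\<^sub>R e i)"
    using assms(2)
  proof (induction rule: span_induct_alt)
    case base
    show ?case by (rule exI[of _ "\<lambda>_. 0"]) simp
  next
    case (step t v w)
    then obtain j c where j: "j \<in> I" "v = e j" and c: "w = (\<Sum>i\<in>I. c i *\<^sub>R e i)" by blast
    have "(\<Sum>i\<in>I. (if i = j then t else 0) *\<^sub>R e i) = (\<Sum>i\<in>{j}. t *\<^sub>R e i)"
      using assms(1) j(1) by (intro sum.mono_neutral_cong_right) auto
    then have "t *\<^sub>R v + w = (\<Sum>i\<in>I. (c i + (if i = j then t else 0)) *\<^sub>R e i)"
      by (simp add: j(2) c scaleR_left_distrib sum.distrib)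
    then show ?case by (intro exI[of _ "\<lambda>i. c i + (if i = j then t else 0)"])
  qed
  then show thesis using that by auto
qed

text \<open>For strictly increasing \<open>p\<close>, an index below \<open>p 0\<close> gets the
  value 0 although it lies in no block; hence the side conditions \<open>p 0 \<le> i\<close>
  below.\<close>

definition block_index :: "(nat \<Rightarrow> nat) \<Rightarrow> nat \<Rightarrow> nat" where
  "block_index p i = (LEAST k. i < p (Suc k))"

lemma block_index_bounds:
  assumes "strict_mono p"
  shows "i < p (Suc (block_index p i))" "p 0 \<le> i \<Longrightarrow> p (block_index p i) \<le> i"
proof -
  have "i < p (Suc i)" using strict_mono_imp_increasing[OF assms, of "Suc i"] by simp
  then show "i < p (Suc (block_index p i))" unfolding block_index_def by (rule LeastI)
  show "p (block_index p i) \<le> i" if "p 0 \<le> i"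
  proof (cases "block_index p i")
    case (Suc k)
    then have "\<not> i < p (Suc k)" unfolding block_index_def by (intro not_less_Least) simp
    then show ?thesis using Suc by simp
  qed (use that in simp)
qed

lemma block_index_eq:
  assumes "strict_mono p" "p k \<le> i" "i < p (Suc k)"
  shows "block_index p i = k"
proof -
  have "p 0 \<le> i" using assms(1,2) by (metis le0 order_trans strict_mono_less_eq)
  note b = block_index_bounds(1)[OF assms(1), of i] block_index_bounds(2)[OF assms(1) this]
  have "p (block_index p i) < p (Suc k)" "p k < p (Suc (block_index p i))" using assms b by linarith+
  then show ?thesis using assms(1) by (simp add: strict_mono_less)
qed

lemma block_index_mono:
  assumes "strict_mono p" "p 0 \<le> i" "i \<le> j"
  shows "block_index p i \<le> block_index p j"
proof -
  have "p (block_index p i) < p (Suc (block_index p j))"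
    using block_index_bounds(1)[OF assms(1), of j] block_index_bounds(2)[OF assms(1,2)] assms(3) by linarith
  then show ?thesis using assms(1) by (simp add: strict_mono_less)
qed

text \<open>A block basis is defined through one coefficient sequence for all blocks; the
  coefficients chosen block by block are glued with \<open>block_index\<close>.\<close>

lemma normalized_block_basisI:
  assumes p: "strict_mono p" and y: "\<And>k. y k \<in> span (e ` {p k..<p (Suc k)})" "\<And>k. norm (y k) = 1"
  shows "normalized_block_basis e y"
proof -
  have "\<forall>k. \<exists>c. y k = (\<Sum>i\<in>{p k..<p (Suc k)}. c i *\<^sub>R e i)"
  proof
    show "\<exists>c. y k = (\<Sum>i\<in>{p k..<p (Suc k)}. c i *\<^sub>R e i)" for k
      by (rule span_image_finite_sum[OF _ y(1)[of k]]) auto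
  qed
  then obtain c where c: "\<And>k. y k = (\<Sum>i\<in>{p k..<p (Suc k)}. c k i *\<^sub>R e i)" by metis
  have "y k = (\<Sum>i\<in>{p k..<p (Suc k)}. c (block_index p i) i *\<^sub>R e i)" for k
    unfolding c using block_index_eq[OF p, of k] by (intro sum.cong) simp_all
  then have "\<forall>k. y k = (\<Sum>i\<in>{p k..<p (Suc k)}. c (block_index p i) i *\<^sub>R e i)" ..
  then show ?thesis unfolding normalized_block_basis_def
    using p y(2) by (intro conjI exI[of _ p] exI[of _ "\<lambda>i. c (block_index p i) i"]) auto
qed

text \<open>Unconditionality and right dominance enter with fixed constants, while the constant in
  \<open>dominates_blocks\<close> may still depend on \<open>y\<close>.\<close>

locale dominant_basis =
  fixes e :: "nat \<Rightarrow> 'a::banach" and K D :: real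
  assumes norm_e: "norm (e i) = 1"
    and basic: "basic_seq e"
    and K_ge_1: "1 \<le> K"
    and projection_bound:
      "x \<in> clspan e \<Longrightarrow> finite F \<Longrightarrow> norm (\<Sum>i\<in>F. biorth e i x *\<^sub>R e i) \<le> K * norm x"
    and D_nonneg: "0 \<le> D"
    and right_dominance: "(\<And>i. m i \<le> n i \<and> n i < m (Suc i)) \<Longrightarrow>
      norm (\<Sum>i<k. b i *\<^sub>R e (m i)) \<le> D * norm (\<Sum>i<k. b i *\<^sub>R e (n i))"
    and dominates_blocks: "normalized_block_basis e y \<Longrightarrow> dominates e y"
begin

lemma suppression:
  assumes "finite G" "F \<subseteq> G"
  shows "norm (\<Sum>i\<in>F. a i *\<^sub>R e i) \<le> K * norm (\<Sum>i\<in>G. a i *\<^sub>R e i)"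
proof -
  have "finite F" using assms finite_subset by blast
  have "(\<Sum>i\<in>F. a i *\<^sub>R e i) = (\<Sum>i\<in>F. biorth e i (\<Sum>j\<in>G. a j *\<^sub>R e j) *\<^sub>R e i)"
    using assms(2) by (intro sum.cong refl) (auto simp: biorth_finite_combination[OF basic assms(1)])
  also have "norm \<dots> \<le> K * norm (\<Sum>i\<in>G. a i *\<^sub>R e i)"
    by (rule projection_bound[OF finite_combination_clspan \<open>finite F\<close>])
  finally show ?thesis .
qed

lemma coefficient_bound:
  assumes "finite G" "i \<in> G"
  shows "\<bar>a i\<bar> \<le> K * norm (\<Sum>i\<in>G. a i *\<^sub>R e i)"
  using suppression[OF assms(1), of "{i}" a] assms(2) by (simp add: norm_e)

text \<open>After division by \<open>M\<close>, the positive and the negative part of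
  \<open>c\<close> both have values in [0,1]. Each is handled by convexity with constant
  \<open>K\<close>, hence the factor 2.\<close>

lemma multiplier:
  assumes "finite G" "\<And>i. i \<in> G \<Longrightarrow> \<bar>c i\<bar> \<le> M"
  shows "norm (\<Sum>i\<in>G. (c i * a i) *\<^sub>R e i) \<le> 2 * K * M * norm (\<Sum>i\<in>G. a i *\<^sub>R e i)"
proof (cases "G = {}")
  case True
  then show ?thesis by simp
next
  case False
  then have M0: "0 \<le> M" using assms(2) by (metis abs_ge_zero all_not_in_conv order_trans)
  let ?A = "norm (\<Sum>i\<in>G. a i *\<^sub>R e i)"
  have pos: "norm (\<Sum>i\<in>G. d i *\<^sub>R (a i *\<^sub>R e i)) \<le> K * ?A"
    if "\<And>i. i \<in> G \<Longrightarrow> 0 \<le> d i \<and> d i \<le> 1" for d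
    using norm_weighted_sum_le[OF assms(1), of 0 "\<lambda>i. a i *\<^sub>R e i" "K * ?A" d]
      suppression[OF assms(1)] that by auto
  show ?thesis
  proof (cases "M = 0")
    case True
    then have "(\<Sum>i\<in>G. (c i * a i) *\<^sub>R e i) = 0" using assms(2) by (intro sum.neutral) force
    then show ?thesis using True by simp
  next
    case False
    with M0 have M: "M > 0" by simp
    let ?p = "\<lambda>i. max 0 (c i / M)" and ?n = "\<lambda>i. max 0 (- c i / M)"
    have "c i * a i = M * (?p i * a i - ?n i * a i)" for i
      using M by (cases "0 \<le> c i") (auto simp: max_def field_simps)
    then have eq: "(\<Sum>i\<in>G. (c i * a i) *\<^sub>R e i) =
        M *\<^sub>R ((\<Sum>i\<in>G. ?p i *\<^sub>R (a i *\<^sub>R e i)) - (\<Sum>i\<in>G. ?n i *\<^sub>R (a i *\<^sub>R e i)))"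
      by (simp add: scaleR_right.sum scaleR_left_diff_distrib scaleR_right_diff_distrib right_diff_distrib
          flip: sum_subtractf)
    have "norm (\<Sum>i\<in>G. ?p i *\<^sub>R (a i *\<^sub>R e i)) \<le> K * ?A" "norm (\<Sum>i\<in>G. ?n i *\<^sub>R (a i *\<^sub>R e i)) \<le> K * ?A"
      using assms(2) M by (intro pos; force simp: field_simps abs_le_iff)+
    then have "norm ((\<Sum>i\<in>G. ?p i *\<^sub>R (a i *\<^sub>R e i)) - (\<Sum>i\<in>G. ?n i *\<^sub>R (a i *\<^sub>R e i))) \<le> K * ?A + K * ?A"
      by (intro norm_triangle_le_diff add_mono)
    then have "M * norm ((\<Sum>i\<in>G. ?p i *\<^sub>R (a i *\<^sub>R e i)) - (\<Sum>i\<in>G. ?n i *\<^sub>R (a i *\<^sub>R e i))) \<le> M * (K * ?A + K * ?A)"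
      using M by (intro mult_left_mono) auto
    then show ?thesis unfolding eq norm_scaleR using M by (simp add: algebra_simps)
  qed
qed

text \<open>The constant depends on the positions \<open>p\<close> only. This matters for the
  J-norm, where the blocks vary with the partition being tested.\<close>

lemma uniform_normalized_block_estimate:
  assumes p: "strict_mono p"
  shows "\<exists>C\<ge>0. \<forall>y N b. (\<forall>k. y k \<in> span (e ` {p k..<p (Suc k)}) \<and> norm (y k) = 1) \<longrightarrow>
    norm (\<Sum>k<N. b k *\<^sub>R y k) \<le> C * norm (\<Sum>k<N. b k *\<^sub>R e k)"
proof (rule ccontr)
  assume neg: "\<not> ?thesis"
  define adm where "adm y \<longleftrightarrow> (\<forall>k. y k \<in> span (e ` {p k..<p (Suc k)}) \<and> norm (y k) = 1)" for y
  have bad: "\<exists>y N b. adm y \<and> norm (\<Sum>k<N. b k *\<^sub>R y k) > C * norm (\<Sum>k<N. b k *\<^sub>R e k)" if "C \<ge> 0" for C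
    using neg that unfolding adm_def by (meson not_le)
  text \<open>Unboundedness persists on tails, so bad finite stretches can be concatenated to a single block basis.\<close>
  have tail: "\<exists>y N b. adm y \<and> norm (\<Sum>k\<in>{L..<N}. b k *\<^sub>R y k) > real L * norm (\<Sum>k\<in>{L..<N}. b k *\<^sub>R e k)" for L
  proof -
    \<comment> \<open>One half of the excess pays for dropping the first \<open>L\<close> terms,
      whose coefficients are at most \<open>K * ?X\<close>, the other for replacing
      \<open>?X\<close> by the norm of the tail.\<close>
    have "0 \<le> 2 * real L * K" using K_ge_1 by simp
    from bad[OF this] obtain y N b where y: "adm y"
      and big: "norm (\<Sum>k<N. b k *\<^sub>R y k) > 2 * real L * K * norm (\<Sum>k<N. b k *\<^sub>R e k)" by blast
    let ?X = "norm (\<Sum>k<N. b k *\<^sub>R e k)"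
    have split: "(\<Sum>k<N. b k *\<^sub>R y k) = (\<Sum>k<min L N. b k *\<^sub>R y k) + (\<Sum>k\<in>{L..<N}. b k *\<^sub>R y k)"
    proof -
      have "{..<N} = {..<min L N} \<union> {L..<N}" by auto
      then show ?thesis by (simp add: sum.union_disjoint disjoint_iff)
    qed
    have "norm (\<Sum>k<min L N. b k *\<^sub>R y k) \<le> (\<Sum>k<min L N. \<bar>b k\<bar>)"
      using y by (intro sum_norm_le) (simp add: adm_def)
    also have "\<dots> \<le> (\<Sum>k<min L N. K * ?X)"
      by (intro sum_mono coefficient_bound) auto
    also have "\<dots> \<le> real L * (K * ?X)"
      using K_ge_1 by (simp add: mult_right_mono)
    finally have head: "norm (\<Sum>k<min L N. b k *\<^sub>R y k) \<le> real L * (K * ?X)" .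
    have "norm (\<Sum>k\<in>{L..<N}. b k *\<^sub>R e k) \<le> K * ?X"
      by (rule suppression) auto
    then have "real L * norm (\<Sum>k\<in>{L..<N}. b k *\<^sub>R e k) \<le> real L * (K * ?X)"
      by (intro mult_left_mono) auto
    also have "\<dots> < norm (\<Sum>k\<in>{L..<N}. b k *\<^sub>R y k)"
      using big head norm_triangle_ineq[of "\<Sum>k<min L N. b k *\<^sub>R y k" "\<Sum>k\<in>{L..<N}. b k *\<^sub>R y k"]
      unfolding split by (simp add: algebra_simps)
    finally show ?thesis using y by blast
  qed
  then obtain Y N B where Y: "\<And>L. adm (Y L)"
    and B: "\<And>L. norm (\<Sum>k\<in>{L..<N L}. B L k *\<^sub>R Y L k) > real L * norm (\<Sum>k\<in>{L..<N L}. B L k *\<^sub>R e k)"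
    by metis
  have NL: "L < N L" for L using B[of L] by (cases "L < N L") auto
  \<comment> \<open>The bad stretch found beyond \<open>S j\<close> ends at \<open>N (S j)\<close>,
    where the next one begins. Its ratio exceeds \<open>S j \<ge> j\<close>, hence eventually any
    given \<open>C\<close>.\<close>
  define S where "S = rec_nat 0 (\<lambda>_. N)"
  have S: "S (Suc j) = N (S j)" for j by (simp add: S_def)
  have S0: "S 0 = 0" by (simp add: S_def)
  have Smono: "strict_mono S" by (rule strict_monoI_Suc) (simp add: S NL)
  define y where "y k = Y (S (block_index S k)) k" for k
  have "normalized_block_basis e y"
    using Y by (intro normalized_block_basisI[OF p]) (auto simp: y_def adm_def)
  then have "dominates e y" by (rule dominates_blocks)
  then obtain C where C: "\<And>k a. norm (\<Sum>i<k. a i *\<^sub>R y i) \<le> C * norm (\<Sum>i<k. a i *\<^sub>R e i)"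
    unfolding dominates_def by blast
  obtain j where j: "C \<le> real j" using real_arch_simple by blast
  let ?I = "{S j..<S (Suc j)}"
  define a where "a k = (if S j \<le> k then B (S j) k else 0)" for k
  have cut: "(\<Sum>i<S (Suc j). a i *\<^sub>R f i) = (\<Sum>i\<in>?I. B (S j) i *\<^sub>R f i)" for f :: "nat \<Rightarrow> 'a"
    by (rule sum.mono_neutral_cong_right) (auto simp: a_def)
  have "(\<Sum>i\<in>?I. B (S j) i *\<^sub>R y i) = (\<Sum>i\<in>?I. B (S j) i *\<^sub>R Y (S j) i)"
    by (rule sum.cong) (auto simp: y_def block_index_eq[OF Smono])
  then have "norm (\<Sum>i\<in>?I. B (S j) i *\<^sub>R Y (S j) i) \<le> C * norm (\<Sum>i\<in>?I. B (S j) i *\<^sub>R e i)"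
    using C[where k = "S (Suc j)" and a = a] by (simp add: cut)
  also have "\<dots> \<le> real (S j) * norm (\<Sum>i\<in>?I. B (S j) i *\<^sub>R e i)"
    using j strict_mono_imp_increasing[OF Smono, of j] by (intro mult_right_mono) auto
  also have "\<dots> < norm (\<Sum>i\<in>?I. B (S j) i *\<^sub>R Y (S j) i)"
    using B[of "S j"] by (simp add: S)
  finally show False by simp
qed

lemma uniform_block_estimate:
  assumes p: "strict_mono p"
  obtains C where "C \<ge> 0" "\<And>M y N b. (\<And>k. y k \<in> span (e ` {p k..<p (Suc k)})) \<Longrightarrow> (\<And>k. norm (y k) \<le> M) \<Longrightarrow>
    norm (\<Sum>k<N. b k *\<^sub>R y k) \<le> C * M * norm (\<Sum>k<N. b k *\<^sub>R e k)"
proof -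
  obtain C where C: "C \<ge> 0" "\<And>y N b. (\<forall>k. y k \<in> span (e ` {p k..<p (Suc k)}) \<and> norm (y k) = 1) \<Longrightarrow>
    norm (\<Sum>k<N. b k *\<^sub>R y k) \<le> C * norm (\<Sum>k<N. b k *\<^sub>R e k)"
    using uniform_normalized_block_estimate[OF p] by blast
  show thesis
  proof (rule that[of "C * (2 * K)"])
    show "C * (2 * K) \<ge> 0" using C(1) K_ge_1 by simp
    fix M y N b assume y: "\<And>k. y k \<in> span (e ` {p k..<p (Suc k)})" "\<And>k. norm (y k) \<le> M"
    \<comment> \<open>A zero block may be replaced by any unit vector of its interval, since its
      norm, moved into the coefficient, is 0.\<close>
    define z where "z k = (if y k = 0 then e (p k) else (1 / norm (y k)) *\<^sub>R y k)" for k
    have "z k \<in> span (e ` {p k..<p (Suc k)})" for k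
    proof -
      have "e (p k) \<in> span (e ` {p k..<p (Suc k)})"
        using p by (intro span_base imageI) (simp add: strict_mono_less)
      then show ?thesis using y(1)[of k] by (auto simp: z_def intro: span_mul)
    qed
    moreover have "norm (z k) = 1" for k by (simp add: z_def norm_e)
    ultimately have z: "\<forall>k. z k \<in> span (e ` {p k..<p (Suc k)}) \<and> norm (z k) = 1" by simp
    have "y k = norm (y k) *\<^sub>R z k" for k by (simp add: z_def)
    then have "(\<Sum>k<N. b k *\<^sub>R y k) = (\<Sum>k<N. (norm (y k) * b k) *\<^sub>R z k)"
      by (metis (no_types) mult.commute scaleR_scaleR)
    also have "norm \<dots> \<le> C * norm (\<Sum>k<N. (norm (y k) * b k) *\<^sub>R e k)" by (rule C(2)[OF z])
    also have "\<dots> \<le> C * (2 * K * M * norm (\<Sum>k<N. b k *\<^sub>R e k))"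
      using C(1) y(2) by (intro mult_left_mono multiplier) auto
    finally show "norm (\<Sum>k<N. b k *\<^sub>R y k) \<le> C * (2 * K) * M * norm (\<Sum>k<N. b k *\<^sub>R e k)"
      by (simp add: mult_ac)
  qed
qed

end

section \<open>Zero-sum blocks of the unit vectors of J\<close>

lemma sum_consecutive_blocks:
  fixes f :: "nat \<Rightarrow> 'b::comm_monoid_add"
  assumes "mono p"
  shows "(\<Sum>i<k. \<Sum>j\<in>{p i..<p (Suc i)}. f j) = (\<Sum>j\<in>{p 0..<p k}. f j)"
proof (induction k)
  case (Suc k)
  have "p 0 \<le> p k" "p k \<le> p (Suc k)" using assms by (auto simp: mono_def)
  then show ?case using Suc by (simp add: sum.atLeastLessThan_concat)
qed simp

lemma sum_interval_diff:
  fixes f :: "nat \<Rightarrow> 'b::ab_group_add"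
  assumes "m \<le> n"
  shows "(\<Sum>j\<in>{m..<n}. f j) = (\<Sum>j<n. f j) - (\<Sum>j<m. f j)"
  using sum.atLeastLessThan_concat[of 0 m n f] assms by (simp add: lessThan_atLeast0 algebra_simps)

context dominant_basis
begin

lemma suppression_subsequence:
  assumes "finite G" "F \<subseteq> G" "inj_on q G"
  shows "norm (\<Sum>i\<in>F. a i *\<^sub>R e (q i)) \<le> K * norm (\<Sum>i\<in>G. a i *\<^sub>R e (q i))"
proof -
  let ?c = "\<lambda>j. a (inv_into G q j)"
  have eq: "(\<Sum>i\<in>H. a i *\<^sub>R e (q i)) = (\<Sum>j\<in>q ` H. ?c j *\<^sub>R e j)" if "H \<subseteq> G" for H
  proof -
    have "(\<Sum>j\<in>q ` H. ?c j *\<^sub>R e j) = (\<Sum>i\<in>H. ?c (q i) *\<^sub>R e (q i))"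
      using inj_on_subset[OF assms(3) that] by (simp add: sum.reindex)
    also have "\<dots> = (\<Sum>i\<in>H. a i *\<^sub>R e (q i))"
      using that by (intro sum.cong refl) (simp add: inv_into_f_f[OF assms(3)] subset_iff)
    finally show ?thesis ..
  qed
  show ?thesis
    unfolding eq[OF assms(2)] eq[OF order_refl] by (rule suppression) (use assms in auto)
qed

text \<open>\<open>Sup\<close> says nothing about an unbounded set of reals, so the supremum in
  \<open>Jnorm\<close> is first seen to be at most the \<open>l1\<close> norm of the
  coefficients.\<close>

lemma Jnorm_bdd_above:
  assumes "\<forall>i\<ge>N. a i = 0"
  shows "bdd_above {norm (\<Sum>i<k. (\<Sum>j\<in>{p i..<p (Suc i)}. a j) *\<^sub>R e (p i)) | k p.
           p 0 = 0 \<and> strict_mono (p::nat \<Rightarrow> nat)}"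
    and "p 0 = 0 \<Longrightarrow> strict_mono p \<Longrightarrow>
      norm (\<Sum>i<k. (\<Sum>j\<in>{p i..<p (Suc i)}. a j) *\<^sub>R e (p i)) \<le> (\<Sum>j<N. \<bar>a j\<bar>)"
proof -
  have *: "norm (\<Sum>i<k. (\<Sum>j\<in>{p i..<p (Suc i)}. a j) *\<^sub>R e (p i)) \<le> (\<Sum>j<N. \<bar>a j\<bar>)"
    if p: "p 0 = 0" "strict_mono p" for p k
  proof -
    have "norm (\<Sum>i<k. (\<Sum>j\<in>{p i..<p (Suc i)}. a j) *\<^sub>R e (p i)) \<le> (\<Sum>i<k. \<Sum>j\<in>{p i..<p (Suc i)}. \<bar>a j\<bar>)"
      by (intro sum_norm_le) (simp add: norm_e sum_abs)
    also have "\<dots> = (\<Sum>j<p k. \<bar>a j\<bar>)"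
      using sum_consecutive_blocks[OF strict_mono_mono[OF p(2)]] p(1) by (simp add: lessThan_atLeast0)
    also have "\<dots> \<le> (\<Sum>j\<in>{..<p k} \<union> {..<N}. \<bar>a j\<bar>)" by (rule sum_mono2) auto
    also have "\<dots> = (\<Sum>j<N. \<bar>a j\<bar>)" by (rule sum.mono_neutral_right) (use assms in auto)
    finally show ?thesis .
  qed
  show "bdd_above {norm (\<Sum>i<k. (\<Sum>j\<in>{p i..<p (Suc i)}. a j) *\<^sub>R e (p i)) | k p.
           p 0 = 0 \<and> strict_mono (p::nat \<Rightarrow> nat)}"
    by (rule bdd_aboveI[of _ "\<Sum>j<N. \<bar>a j\<bar>"]) (use * in blast)
  show "p 0 = 0 \<Longrightarrow> strict_mono p \<Longrightarrow>
      norm (\<Sum>i<k. (\<Sum>j\<in>{p i..<p (Suc i)}. a j) *\<^sub>R e (p i)) \<le> (\<Sum>j<N. \<bar>a j\<bar>)" by (rule *)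
qed

end

locale james_space = dominant_basis e K D
  for e :: "nat \<Rightarrow> 'a::banach" and K D +
  fixes u :: "nat \<Rightarrow> 'j::banach"
  assumes J_space: "is_J_space e u"
begin

lemma norm_J:
  assumes "\<forall>i\<ge>N. a i = 0"
  shows "norm (\<Sum>i<N. a i *\<^sub>R u i) = Jnorm e a"
proof -
  have "(\<lambda>i. if i < N then a i else 0) = a" using assms by (auto simp: not_less)
  then show ?thesis using J_space unfolding is_J_space_def by metis
qed

lemma norm_J_ge:
  assumes "\<forall>i\<ge>N. a i = 0" "p 0 = 0" "strict_mono p"
  shows "norm (\<Sum>i<k. (\<Sum>j\<in>{p i..<p (Suc i)}. a j) *\<^sub>R e (p i)) \<le> norm (\<Sum>i<N. a i *\<^sub>R u i)"
  unfolding norm_J[OF assms(1)] Jnorm_def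
  by (rule cSup_upper[OF _ Jnorm_bdd_above(1)[OF assms(1)]]) (use assms(2,3) in blast)

lemma norm_J_le:
  assumes "\<forall>i\<ge>N. a i = 0"
    "\<And>k p. p 0 = 0 \<Longrightarrow> strict_mono p \<Longrightarrow>
      norm (\<Sum>i<k. (\<Sum>j\<in>{p i..<p (Suc i)}. a j) *\<^sub>R e (p i)) \<le> B"
  shows "norm (\<Sum>i<N. a i *\<^sub>R u i) \<le> B"
  unfolding norm_J[OF assms(1)] Jnorm_def
proof (rule cSup_least)
  have "strict_mono (\<lambda>i::nat. i)" by (simp add: strict_mono_def)
  then show "{norm (\<Sum>i<k. (\<Sum>j\<in>{p i..<p (Suc i)}. a j) *\<^sub>R e (p i)) | k p.
           p 0 = 0 \<and> strict_mono (p::nat \<Rightarrow> nat)} \<noteq> {}" by auto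
qed (use assms(2) in blast)

lemma norm_J_le_sum_abs:
  assumes "\<forall>i\<ge>N. a i = 0"
  shows "norm (\<Sum>i<N. a i *\<^sub>R u i) \<le> (\<Sum>i<N. \<bar>a i\<bar>)"
  by (rule norm_J_le[OF assms Jnorm_bdd_above(2)[OF assms]])

text \<open>Test the J-norm with a partition whose first interval is \<open>{..<x}\<close>, and keep
  only the first term.\<close>

lemma norm_J_ge_initial_sum:
  assumes "\<forall>i\<ge>N. a i = 0"
  shows "\<bar>\<Sum>j<x. a j\<bar> \<le> norm (\<Sum>i<N. a i *\<^sub>R u i)"
proof (cases x)
  case (Suc y)
  define p where "p i = (if i = 0 then 0 else y + i)" for i
  have "p 0 = 0" "strict_mono p" by (auto simp: p_def strict_mono_def)
  from norm_J_ge[OF assms this, where k = 1]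
  have "norm ((\<Sum>j\<in>{p 0..<p 1}. a j) *\<^sub>R e (p 0)) \<le> norm (\<Sum>i<N. a i *\<^sub>R u i)" by simp
  then show ?thesis by (simp add: p_def norm_e Suc lessThan_atLeast0 del: sum.op_ivl_Suc sum.lessThan_Suc)
qed simp

text \<open>The partition into singletons is admissible in the supremum; thus \<open>u\<close>
  dominates \<open>e\<close>.\<close>

lemma norm_J_ge_basis:
  "norm (\<Sum>i<N. a i *\<^sub>R e i) \<le> norm (\<Sum>i<N. a i *\<^sub>R u i)"
proof -
  define b where "b i = (if i < N then a i else 0)" for i
  have "strict_mono (\<lambda>i::nat. i)" by (simp add: strict_mono_def)
  have "\<forall>i\<ge>N. b i = 0" by (simp add: b_def)
  from norm_J_ge[OF this refl \<open>strict_mono (\<lambda>i::nat. i)\<close>, of N]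
  show ?thesis by (simp add: b_def)
qed

text \<open>The coefficient of \<open>e (q i)\<close> for a partition \<open>q\<close> splits into the part of the interval inside the
  block in which it starts and the part inside the block in which it ends, complete blocks in between
  contributing nothing.  The first parts form a block sequence of \<open>e\<close>; the second parts sit too far to
  the left, which right dominance repairs.\<close>
lemma zero_sum_block_estimate:
  assumes p: "strict_mono p" "p 0 = 0"
    and zero: "\<And>k. (\<Sum>i\<in>{p k..<p (Suc k)}. a i) = 0"
    and M: "\<And>k. norm (\<Sum>i\<in>{p k..<p (Suc k)}. a i *\<^sub>R u i) \<le> M"
  obtains C where "\<And>N b. norm (\<Sum>k<N. b k *\<^sub>R (\<Sum>i\<in>{p k..<p (Suc k)}. a i *\<^sub>R u i))
    \<le> C * norm (\<Sum>k<N. b k *\<^sub>R e k)"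
proof -
  obtain C where C: "C \<ge> 0" "\<And>M y N b. (\<And>k. y k \<in> span (e ` {p k..<p (Suc k)})) \<Longrightarrow> (\<And>k. norm (y k) \<le> M) \<Longrightarrow>
    norm (\<Sum>k<N. b k *\<^sub>R y k) \<le> C * M * norm (\<Sum>k<N. b k *\<^sub>R e k)"
    by (rule uniform_block_estimate[OF p(1)]) blast
  have M0: "0 \<le> M" using M[of 0] norm_ge_zero order_trans by blast
  let ?bi = "block_index p"
  note bi = block_index_bounds(1)[OF p(1)] block_index_bounds(2)[OF p(1), unfolded p(2), OF le0]
  have bi_mono: "?bi i \<le> ?bi j" if "i \<le> j" for i j
    using block_index_mono[OF p(1) _ that] p(2) by simp
  define s where "s x = (\<Sum>j<x. a j)" for x
  have sp: "s (p k) = 0" for k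
    using sum_consecutive_blocks[OF strict_mono_mono[OF p(1)], of a k] p(2) zero
    by (simp add: s_def lessThan_atLeast0)
  \<comment> \<open>The multiplier is constant on blocks and complete blocks sum to 0, so only the
    unfinished block at \<open>x\<close> survives.\<close>
  have cum: "(\<Sum>j<x. \<beta> (?bi j) * a j) = \<beta> (?bi x) * s x" for \<beta> x
  proof (induction x)
    case 0
    show ?case by (simp add: s_def)
  next
    case (Suc x)
    then have *: "(\<Sum>j<Suc x. \<beta> (?bi j) * a j) = \<beta> (?bi x) * s (Suc x)"
      by (simp add: s_def algebra_simps)
    show ?case
    proof (cases "Suc x < p (Suc (?bi x))")
      case True
      then have "?bi (Suc x) = ?bi x" using bi[of x] by (intro block_index_eq[OF p(1)]) auto
      then show ?thesis using * by simp
    next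
      case False
      then have "Suc x = p (Suc (?bi x))" using bi[of x] by simp
      then have "s (Suc x) = 0" using sp by simp
      then show ?thesis using * by simp
    qed
  qed
  have block_as_initial: "(\<Sum>j<p (Suc m). ((if ?bi j = m then 1 else 0) * a j) *\<^sub>R u j) = (\<Sum>i\<in>{p m..<p (Suc m)}. a i *\<^sub>R u i)" for m
  proof (rule sum.mono_neutral_cong_right)
    show "\<forall>i\<in>{..<p (Suc m)} - {p m..<p (Suc m)}. ((if ?bi i = m then 1 else 0) * a i) *\<^sub>R u i = 0"
      using bi(2) by auto
    show "((if ?bi i = m then 1 else 0) * a i) *\<^sub>R u i = a i *\<^sub>R u i" if "i \<in> {p m..<p (Suc m)}" for i
      using that block_index_eq[OF p(1), of m i] by simp
  qed auto
  have block_supp: "\<forall>i\<ge>p (Suc m). (if ?bi i = m then 1 else 0) * a i = 0" for m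
  proof (intro allI impI)
    fix i assume "p (Suc m) \<le> i"
    then have "?bi i \<noteq> m" using bi(1)[of i] by auto
    then show "(if ?bi i = m then 1 else 0) * a i = 0" by simp
  qed
  show thesis
  proof (rule that[of "C * (K * M) + D * (C * M)"])
    fix N and b :: "nat \<Rightarrow> real"
    define \<beta> where "\<beta> k = (if k < N then b k else 0)" for k
    let ?B = "norm (\<Sum>k<N. b k *\<^sub>R e k)"
    have \<beta>_extend: "(\<Sum>k<N'. \<beta> k *\<^sub>R e k) = (\<Sum>k<N. b k *\<^sub>R e k)" if "N \<le> N'" for N'
      by (rule sum.mono_neutral_cong_right) (use that in \<open>auto simp: \<beta>_def\<close>)
    have supp: "\<forall>i\<ge>p N. \<beta> (?bi i) * a i = 0"
    proof (intro allI impI)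
      fix i assume "p N \<le> i"
      then have "p N < p (Suc (?bi i))" using bi(1)[of i] by simp
      then have "N \<le> ?bi i" using p(1) by (simp add: strict_mono_less)
      then show "\<beta> (?bi i) * a i = 0" by (simp add: \<beta>_def)
    qed
    have "(\<Sum>k<N. b k *\<^sub>R (\<Sum>i\<in>{p k..<p (Suc k)}. a i *\<^sub>R u i)) =
        (\<Sum>k<N. \<Sum>i\<in>{p k..<p (Suc k)}. (\<beta> (?bi i) * a i) *\<^sub>R u i)"
      using block_index_eq[OF p(1)] by (auto simp: scaleR_right.sum \<beta>_def intro!: sum.cong)
    also have "\<dots> = (\<Sum>i<p N. (\<beta> (?bi i) * a i) *\<^sub>R u i)"
      using sum_consecutive_blocks[OF strict_mono_mono[OF p(1)]] p(2) by (simp add: lessThan_atLeast0)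
    finally have eq: "(\<Sum>k<N. b k *\<^sub>R (\<Sum>i\<in>{p k..<p (Suc k)}. a i *\<^sub>R u i)) = (\<Sum>i<p N. (\<beta> (?bi i) * a i) *\<^sub>R u i)" .
    show "norm (\<Sum>k<N. b k *\<^sub>R (\<Sum>i\<in>{p k..<p (Suc k)}. a i *\<^sub>R u i)) \<le> (C * (K * M) + D * (C * M)) * ?B"
      unfolding eq
    proof (rule norm_J_le[OF supp])
      fix n q assume q: "q 0 = 0" "strict_mono (q :: nat \<Rightarrow> nat)"
      define k where "k i = ?bi (q i)" for i
      define l where "l i = ?bi (q (Suc i))" for i
      \<comment> \<open>An interval inside one block belongs to \<open>t\<close> entirely. Otherwise
        \<open>t i = - s (q i)\<close> is the rest of the block it starts in, and \<open>h i\<close>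
        is the beginning of the block it ends in.\<close>
      define t where "t i = (if k i = l i then s (q (Suc i)) else 0) - s (q i)" for i
      define h where "h i = (if k i < l i then s (q (Suc i)) else 0)" for i
      have q_le: "q i \<le> q j" if "i \<le> j" for i j using q(2) that by (simp add: strict_mono_less_eq)
      have kl: "k i \<le> l i" for i unfolding k_def l_def by (intro bi_mono q_le) simp
      have T: "(\<Sum>j\<in>{q i..<q (Suc i)}. \<gamma> (?bi j) * a j) = \<gamma> (k i) * t i + \<gamma> (l i) * h i" for \<gamma> i
      proof -
        have "(\<Sum>j\<in>{q i..<q (Suc i)}. \<gamma> (?bi j) * a j) = \<gamma> (l i) * s (q (Suc i)) - \<gamma> (k i) * s (q i)"
          by (simp only: sum_interval_diff[OF q_le[of i "Suc i", OF le_SucI[OF order_refl]]] cum k_def l_def)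
        then show ?thesis using kl[of i] by (auto simp: t_def h_def algebra_simps)
      qed
      define N' where "N' = N + Suc (?bi (q n))"
      have lN': "l i < N'" if "i < n" for i
        using bi_mono[OF q_le[of "Suc i" n]] that by (simp add: l_def N'_def)
      have lN: "l ` {..<n} \<subseteq> {..<N'}" using lN' by auto
      have kN: "k ` {..<n} \<subseteq> {..<N'}" using lN' kl by (auto intro: le_less_trans)
      have NN': "N \<le> N'" by (simp add: N'_def)

      define y where "y m = (\<Sum>i\<in>{i \<in> {..<n}. k i = m}. t i *\<^sub>R e (q i))" for m
      have y_span: "y m \<in> span (e ` {p m..<p (Suc m)})" for m
        unfolding y_def by (intro span_sum span_mul span_base imageI) (use bi in \<open>auto simp: k_def\<close>)
      \<comment> \<open>With the indicator of block \<open>m\<close> in place of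
        \<open>\<beta>\<close>, the formula \<open>T\<close> tests the J-norm of that block alone.
        End parts do not interfere: for \<open>k i = m\<close>, either \<open>l i = m\<close> and
        \<open>h i = 0\<close>, or the indicator vanishes at \<open>l i\<close>.\<close>
      have y_norm: "norm (y m) \<le> K * M" for m
      proof -
        let ?\<gamma> = "\<lambda>j. if j = m then 1 else 0"
        have y_eq: "y m = (\<Sum>i\<in>{i \<in> {..<n}. k i = m}. (?\<gamma> (k i) * t i + ?\<gamma> (l i) * h i) *\<^sub>R e (q i))"
          unfolding y_def by (rule sum.cong) (auto simp: h_def)
        have "norm (y m) \<le> K * norm (\<Sum>i<n. (?\<gamma> (k i) * t i + ?\<gamma> (l i) * h i) *\<^sub>R e (q i))"
          unfolding y_eq by (rule suppression_subsequence) (use strict_mono_imp_inj_on[OF q(2)] in \<open>auto intro: inj_on_subset\<close>)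
        also have "\<dots> \<le> K * norm (\<Sum>j<p (Suc m). (?\<gamma> (?bi j) * a j) *\<^sub>R u j)"
          unfolding T[of ?\<gamma>, symmetric]
          by (rule mult_left_mono[OF norm_J_ge[OF block_supp q]]) (use K_ge_1 in auto)
        also have "\<dots> \<le> K * M"
          unfolding block_as_initial by (rule mult_left_mono[OF M]) (use K_ge_1 in auto)
        finally show ?thesis .
      qed
      have "(\<Sum>i<n. (\<beta> (k i) * t i) *\<^sub>R e (q i)) = (\<Sum>m<N'. \<Sum>i\<in>{i \<in> {..<n}. k i = m}. (\<beta> (k i) * t i) *\<^sub>R e (q i))"
        by (rule sum.group[symmetric]) (use kN in auto)
      also have "\<dots> = (\<Sum>m<N'. \<beta> m *\<^sub>R y m)"
        by (auto simp: y_def scaleR_right.sum intro!: sum.cong)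
      finally have "norm (\<Sum>i<n. (\<beta> (k i) * t i) *\<^sub>R e (q i)) \<le> C * (K * M) * norm (\<Sum>m<N'. \<beta> m *\<^sub>R e m)"
        using C(2)[OF y_span y_norm, of \<beta> N'] by simp
      then have start: "norm (\<Sum>i<n. (\<beta> (k i) * t i) *\<^sub>R e (q i)) \<le> C * (K * M) * ?B"
        by (simp add: \<beta>_extend[OF NN'])

      \<comment> \<open>Since \<open>s\<close> vanishes at block boundaries, only an end point
        strictly inside its block matters. Then \<open>q i < p (l i) < q (Suc i)\<close>, and
        placing the coefficient at \<open>p (l i)\<close> gives vectors inside the blocks; right
        dominance with constant \<open>D\<close> leads back to \<open>q i\<close>.\<close>
      define I where "I i \<longleftrightarrow> k i < l i \<and> p (l i) < q (Suc i)" for i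
      define r where "r i = (if I i then p (l i) else q i)" for i
      define z where "z i = (if I i then h i *\<^sub>R e (p (l i)) else 0)" for i
      have nI: "h i = 0" if "\<not> I i" for i
      proof (cases "k i < l i")
        case True
        then have "q (Suc i) = p (l i)" using that bi(2)[of "q (Suc i)"] by (simp add: I_def l_def)
        then show ?thesis by (simp add: h_def sp)
      qed (simp add: h_def)
      have r: "q i \<le> r i \<and> r i < q (Suc i)" for i
      proof (cases "I i")
        case True
        then have "p (Suc (k i)) \<le> p (l i)" using p(1) by (simp add: I_def strict_mono_less_eq)
        then show ?thesis using True bi(1)[of "q i"] by (simp add: r_def I_def k_def)
      qed (use q(2) in \<open>simp add: r_def strict_mono_less\<close>)
      define y' where "y' m = (\<Sum>i\<in>{i \<in> {..<n}. l i = m}. z i)" for m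
      have y'_span: "y' m \<in> span (e ` {p m..<p (Suc m)})" for m
        unfolding y'_def
      proof (rule span_sum)
        fix i assume "i \<in> {i \<in> {..<n}. l i = m}"
        moreover have "e (p m) \<in> span (e ` {p m..<p (Suc m)})"
          using p(1) by (intro span_base imageI) (simp add: strict_mono_less)
        ultimately show "z i \<in> span (e ` {p m..<p (Suc m)})"
          by (auto simp: z_def intro: span_mul span_zero)
      qed
      have l_less: "l i < l j" if "i < j" "I j" for i j
      proof -
        have "l i \<le> k j" unfolding l_def k_def using that by (intro bi_mono q_le) simp
        then show ?thesis using that(2) by (simp add: I_def)
      qed
      \<comment> \<open>At most one interval coming from an earlier block ends strictly inside block
        \<open>m\<close>. So \<open>y' m\<close> has at most one nonzero term, whose coefficient is
        an initial sum of that block.\<close>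
      have y'_norm: "norm (y' m) \<le> M" for m
      proof (cases "\<exists>i<n. I i \<and> l i = m")
        case True
        then obtain i where i: "i < n" "I i" "l i = m" by blast
        have "z j = 0" if "j < n" "l j = m" "j \<noteq> i" for j
        proof -
          have "\<not> I j" using that i l_less[of i j] l_less[of j i] by (cases j i rule: linorder_cases) auto
          then show ?thesis by (simp add: z_def)
        qed
        then have "y' m = (\<Sum>j\<in>{i}. z j)"
          unfolding y'_def using i by (intro sum.mono_neutral_right) auto
        then have "norm (y' m) = \<bar>s (q (Suc i))\<bar>" using i(2) by (simp add: z_def norm_e h_def I_def)
        also have "\<dots> = \<bar>\<Sum>j<q (Suc i). (if ?bi j = m then 1 else 0) * a j\<bar>"
          using cum[of "\<lambda>j. if j = m then 1 else 0" "q (Suc i)"] i(3) by (simp add: l_def)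
        also have "\<dots> \<le> norm (\<Sum>j<p (Suc m). ((if ?bi j = m then 1 else 0) * a j) *\<^sub>R u j)"
          by (rule norm_J_ge_initial_sum[OF block_supp])
        also have "\<dots> \<le> M" unfolding block_as_initial by (rule M)
        finally show ?thesis .
      next
        case False
        then have "y' m = 0" unfolding y'_def by (intro sum.neutral) (auto simp: z_def)
        then show ?thesis using M0 by simp
      qed
      have "(\<Sum>i<n. (\<beta> (l i) * h i) *\<^sub>R e (r i)) = (\<Sum>i<n. \<beta> (l i) *\<^sub>R z i)"
        by (rule sum.cong) (auto simp: z_def r_def nI)
      also have "\<dots> = (\<Sum>m<N'. \<Sum>i\<in>{i \<in> {..<n}. l i = m}. \<beta> (l i) *\<^sub>R z i)"
        by (rule sum.group[symmetric]) (use lN in auto)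
      also have "\<dots> = (\<Sum>m<N'. \<beta> m *\<^sub>R y' m)"
        by (auto simp: y'_def scaleR_right.sum intro!: sum.cong)
      finally have "norm (\<Sum>i<n. (\<beta> (l i) * h i) *\<^sub>R e (r i)) \<le> C * M * ?B"
        using C(2)[OF y'_span y'_norm, of \<beta> N'] by (simp add: \<beta>_extend[OF NN'])
      then have "D * norm (\<Sum>i<n. (\<beta> (l i) * h i) *\<^sub>R e (r i)) \<le> D * (C * M * ?B)"
        by (rule mult_left_mono[OF _ D_nonneg])
      moreover have "norm (\<Sum>i<n. (\<beta> (l i) * h i) *\<^sub>R e (q i)) \<le> D * norm (\<Sum>i<n. (\<beta> (l i) * h i) *\<^sub>R e (r i))"
        by (rule right_dominance) (rule r)
      ultimately have end_part: "norm (\<Sum>i<n. (\<beta> (l i) * h i) *\<^sub>R e (q i)) \<le> D * (C * M * ?B)"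
        by linarith

      have split: "(\<Sum>i<n. (\<Sum>j\<in>{q i..<q (Suc i)}. \<beta> (?bi j) * a j) *\<^sub>R e (q i)) =
          (\<Sum>i<n. (\<beta> (k i) * t i) *\<^sub>R e (q i)) + (\<Sum>i<n. (\<beta> (l i) * h i) *\<^sub>R e (q i))"
        by (simp add: T scaleR_left_distrib sum.distrib)
      show "norm (\<Sum>i<n. (\<Sum>j\<in>{q i..<q (Suc i)}. \<beta> (?bi j) * a j) *\<^sub>R e (q i)) \<le>
          (C * (K * M) + D * (C * M)) * ?B"
        unfolding split using norm_triangle_mono[OF start end_part] by (simp add: algebra_simps)
    qed
  qed
qed

end

section \<open>Functionals on J and weakly null sequences\<close>

text \<open>The extension is the closure of the graph of the map on finite combinations.\<close>
lemma extend_from_dense_span: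
  fixes u :: "nat \<Rightarrow> 'j::real_normed_vector" and v :: "nat \<Rightarrow> 'b::banach"
  assumes dense: "closure (span (range u)) = UNIV"
    and bound: "\<And>k a. norm (\<Sum>i<k. a i *\<^sub>R v i) \<le> C * norm (\<Sum>i<k. a i *\<^sub>R u i)"
  obtains T :: "'j \<Rightarrow>\<^sub>L 'b" where "\<And>i. T (u i) = v i" "\<And>x. norm (T x) \<le> C * norm x"
proof -
  \<comment> \<open>A relation, because a vector may be represented by different coefficients.
    Single-valuedness comes from the norm bound, applied to differences, and only for the closure
    \<open>G\<close>.\<close>
  define R where "R x y \<longleftrightarrow> (\<exists>N a. (\<forall>i\<ge>N. a i = 0) \<and> x = (\<Sum>i<N. a i *\<^sub>R u i) \<and> y = (\<Sum>i<N. a i *\<^sub>R v i))" for x y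
  have R_add: "R (x + x') (y + y')" if xy: "R x y" and xy': "R x' y'" for x y x' y'
  proof -
    obtain N a where a: "\<forall>i\<ge>N. a i = 0" "x = (\<Sum>i<N. a i *\<^sub>R u i)" "y = (\<Sum>i<N. a i *\<^sub>R v i)"
      using xy unfolding R_def by blast
    obtain N' a' where a': "\<forall>i\<ge>N'. a' i = 0" "x' = (\<Sum>i<N'. a' i *\<^sub>R u i)" "y' = (\<Sum>i<N'. a' i *\<^sub>R v i)"
      using xy' unfolding R_def by blast
    have e1: "(\<Sum>i<N. a i *\<^sub>R f i) = (\<Sum>i<max N N'. a i *\<^sub>R f i)" for f :: "nat \<Rightarrow> 'c::real_vector"
      by (rule sum.mono_neutral_left) (use a(1) in auto)
    have e2: "(\<Sum>i<N'. a' i *\<^sub>R f i) = (\<Sum>i<max N N'. a' i *\<^sub>R f i)" for f :: "nat \<Rightarrow> 'c::real_vector"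
      by (rule sum.mono_neutral_left) (use a'(1) in auto)
    have "\<forall>i\<ge>max N N'. a i + a' i = 0" using a(1) a'(1) by simp
    then show ?thesis unfolding R_def a(2,3) a'(2,3) e1 e2
      by (intro exI[of _ "max N N'"] exI[of _ "\<lambda>i. a i + a' i"]) (simp add: scaleR_left_distrib sum.distrib)
  qed
  have R_scale: "R (c *\<^sub>R x) (c *\<^sub>R y)" if xy: "R x y" for c x y
  proof -
    obtain N a where a: "\<forall>i\<ge>N. a i = 0" "x = (\<Sum>i<N. a i *\<^sub>R u i)" "y = (\<Sum>i<N. a i *\<^sub>R v i)"
      using xy unfolding R_def by blast
    have "\<forall>i\<ge>N. c * a i = 0" using a(1) by simp
    then show ?thesis unfolding R_def a(2,3) scaleR_right.sum scaleR_scaleR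
      by (intro exI[of _ N] exI[of _ "\<lambda>i. c * a i"] conjI refl)
  qed
  have R_bound: "norm y \<le> C * norm x" if "R x y" for x y
    using that bound unfolding R_def by auto
  have R_base: "R (u j) (v j)" for j
  proof -
    have "(\<Sum>i<Suc j. (if i = j then 1 else 0::real) *\<^sub>R f i) = f j" for f :: "nat \<Rightarrow> 'c::real_vector"
    proof -
      have "(\<Sum>i<Suc j. (if i = j then 1 else 0::real) *\<^sub>R f i) = (\<Sum>i\<in>{j}. f i)"
        by (rule sum.mono_neutral_cong_right) auto
      then show ?thesis by simp
    qed
    then show ?thesis unfolding R_def
      by (intro exI[of _ "Suc j"] exI[of _ "\<lambda>i. if i = j then 1 else 0"]) simp
  qed
  have R_0: "R 0 0" using R_scale[OF R_base, of 0 0] by simp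
  have R_span: "\<exists>y. R x y" if "x \<in> span (range u)" for x
    using that
  proof (induction rule: span_induct_alt)
    case base
    show ?case using R_0 by blast
  next
    case (step c w x)
    then obtain j y where "w = u j" "R x y" by auto
    then show ?case using R_add[OF R_scale[OF R_base]] by blast
  qed
  define G where "G z w \<longleftrightarrow> (\<exists>f g. (\<forall>n. R (f n) (g n)) \<and> f \<longlonglongrightarrow> z \<and> g \<longlonglongrightarrow> w)" for z w
  have G_add: "G (z + z') (w + w')" if zw: "G z w" and zw': "G z' w'" for z w z' w'
  proof -
    obtain f g where 1: "\<forall>n. R (f n) (g n)" "f \<longlonglongrightarrow> z" "g \<longlonglongrightarrow> w" using zw unfolding G_def by blast
    obtain f' g' where 2: "\<forall>n. R (f' n) (g' n)" "f' \<longlonglongrightarrow> z'" "g' \<longlonglongrightarrow> w'" using zw' unfolding G_def by blast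
    show ?thesis unfolding G_def
      by (intro exI[of _ "\<lambda>n. f n + f' n"] exI[of _ "\<lambda>n. g n + g' n"] conjI allI R_add tendsto_add)
        (use 1 2 in auto)
  qed
  have G_scale: "G (c *\<^sub>R z) (c *\<^sub>R w)" if zw: "G z w" for c z w
  proof -
    obtain f g where 1: "\<forall>n. R (f n) (g n)" "f \<longlonglongrightarrow> z" "g \<longlonglongrightarrow> w" using zw unfolding G_def by blast
    show ?thesis unfolding G_def
      by (intro exI[of _ "\<lambda>n. c *\<^sub>R f n"] exI[of _ "\<lambda>n. c *\<^sub>R g n"] conjI allI R_scale tendsto_scaleR tendsto_const)
        (use 1 in auto)
  qed
  have G_bound: "norm w \<le> C * norm z" if zw: "G z w" for z w
  proof -
    obtain f g where 1: "\<forall>n. R (f n) (g n)" "f \<longlonglongrightarrow> z" "g \<longlonglongrightarrow> w" using zw unfolding G_def by blast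
    have "(\<lambda>n. C * norm (f n)) \<longlonglongrightarrow> C * norm z" by (intro tendsto_intros 1)
    moreover have "(\<lambda>n. norm (g n)) \<longlonglongrightarrow> norm w" by (intro tendsto_intros 1)
    ultimately show ?thesis using R_bound 1(1) by (intro LIMSEQ_le) auto
  qed
  have G_unique: "w = w'" if "G z w" "G z w'" for z w w'
    using G_bound[OF G_add[OF that(1) G_scale[OF that(2), of "-1"]]] by simp
  have G_total: "\<exists>w. G z w" for z
  proof -
    have "z \<in> closure (span (range u))" using dense by simp
    then obtain f where f: "\<forall>n. f n \<in> span (range u)" "f \<longlonglongrightarrow> z" unfolding closure_sequential by blast
    then have "\<forall>n. \<exists>y. R (f n) y" using R_span by blast
    then obtain g where g: "\<forall>n. R (f n) (g n)" by metis
    have R_diff: "R (f m - f n) (g m - g n)" for m n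
      using R_add[OF g[rule_format, of m] R_scale[OF g[rule_format, of n], of "-1"]] by simp
    have "Cauchy g"
    proof (rule CauchyI)
      fix \<epsilon> :: real assume \<epsilon>: "0 < \<epsilon>"
      have "Cauchy f" using f(2) by (rule LIMSEQ_imp_Cauchy)
      then obtain M where M: "\<forall>m\<ge>M. \<forall>n\<ge>M. norm (f m - f n) < \<epsilon> / (\<bar>C\<bar> + 1)"
        using \<epsilon> by (auto dest: CauchyD[of f "\<epsilon> / (\<bar>C\<bar> + 1)"])
      have "norm (g m - g n) < \<epsilon>" if "m \<ge> M" "n \<ge> M" for m n
      proof -
        have "norm (g m - g n) \<le> C * norm (f m - f n)" by (rule R_bound[OF R_diff])
        also have "\<dots> \<le> (\<bar>C\<bar> + 1) * norm (f m - f n)" by (rule mult_right_mono) auto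
        also have "\<dots> < \<epsilon>" using M that by (simp add: field_simps)
        finally show ?thesis .
      qed
      then show "\<exists>M. \<forall>m\<ge>M. \<forall>n\<ge>M. norm (g m - g n) < \<epsilon>" by blast
    qed
    then obtain w where "g \<longlonglongrightarrow> w" using Cauchy_convergent_iff convergent_def by blast
    then show ?thesis unfolding G_def using f(2) g by blast
  qed
  define T where "T z = (SOME w. G z w)" for z
  have T: "G z (T z)" for z unfolding T_def using G_total by (rule someI_ex)
  have bl: "bounded_linear T"
  proof (rule bounded_linear_intro)
    show "T (x + y) = T x + T y" for x y by (rule G_unique[OF T G_add[OF T T]])
    show "T (c *\<^sub>R x) = c *\<^sub>R T x" for c x by (rule G_unique[OF T G_scale[OF T]])
    show "norm (T x) \<le> norm x * C" for x using G_bound[OF T] by (simp add: mult.commute)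
  qed
  have "G (u j) (v j)" for j unfolding G_def
    by (intro exI[of _ "\<lambda>_. u j"] exI[of _ "\<lambda>_. v j"]) (simp add: R_base)
  then have "T (u j) = v j" for j by (intro G_unique[OF T])
  then show thesis
    using G_bound[OF T] by (intro that[of "Blinfun T"]) (simp_all add: bounded_linear_Blinfun_apply[OF bl])
qed

context dominant_basis
begin

text \<open>\<open>e\<close> dominates its own subsequence, a block sequence with blocks of one
  vector; this in turn dominates the corresponding subsequence of \<open>x\<close>.\<close>

lemma dominates_subsequence:
  assumes "dominates e x" "strict_mono r"
  shows "dominates e (\<lambda>k. x (r k))"
proof -
  obtain C where C: "\<And>N a. norm (\<Sum>i<N. a i *\<^sub>R x i) \<le> C * norm (\<Sum>i<N. a i *\<^sub>R e i)"
    using assms(1) unfolding dominates_def by blast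
  obtain C' where C': "C' \<ge> 0" "\<And>M y N b. (\<And>k. y k \<in> span (e ` {r k..<r (Suc k)})) \<Longrightarrow> (\<And>k. norm (y k) \<le> M) \<Longrightarrow>
    norm (\<Sum>k<N. b k *\<^sub>R y k) \<le> C' * M * norm (\<Sum>k<N. b k *\<^sub>R e k)"
    by (rule uniform_block_estimate[OF assms(2)]) blast
  have sub: "norm (\<Sum>k<N. b k *\<^sub>R e (r k)) \<le> C' * norm (\<Sum>k<N. b k *\<^sub>R e k)" for N b
  proof -
    have "e (r k) \<in> span (e ` {r k..<r (Suc k)})" for k
      using assms(2) by (intro span_base imageI) (simp add: strict_mono_less)
    from C'(2)[where y = "\<lambda>k. e (r k)" and M = 1, OF this] show ?thesis by (simp add: norm_e)
  qed
  have inj: "inj r" using assms(2) by (rule strict_mono_imp_inj_on)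
  show ?thesis unfolding dominates_def
  proof (intro exI[of _ "\<bar>C\<bar> * C'"] allI)
    fix N and b :: "nat \<Rightarrow> real"
    define c where "c j = (if j \<in> r ` {..<N} then b (inv r j) else 0)" for j
    have ext: "(\<Sum>k<N. b k *\<^sub>R f (r k)) = (\<Sum>j<r N. c j *\<^sub>R f j)" for f :: "nat \<Rightarrow> 'c::real_vector"
    proof -
      have "(\<Sum>j<r N. c j *\<^sub>R f j) = (\<Sum>j\<in>r ` {..<N}. c j *\<^sub>R f j)"
        by (rule sum.mono_neutral_right) (use assms(2) in \<open>auto simp: c_def strict_mono_less\<close>)
      also have "\<dots> = (\<Sum>k<N. c (r k) *\<^sub>R f (r k))"
        using sum.reindex[OF inj_on_subset[OF inj subset_UNIV[of "{..<N}"]]] by simp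
      also have "\<dots> = (\<Sum>k<N. b k *\<^sub>R f (r k))"
        by (rule sum.cong) (auto simp: c_def inv_f_f[OF inj])
      finally show ?thesis ..
    qed
    have "norm (\<Sum>k<N. b k *\<^sub>R x (r k)) \<le> C * norm (\<Sum>k<N. b k *\<^sub>R e (r k))"
      unfolding ext by (rule C)
    also have "\<dots> \<le> \<bar>C\<bar> * norm (\<Sum>k<N. b k *\<^sub>R e (r k))" by (rule mult_right_mono) auto
    also have "\<dots> \<le> \<bar>C\<bar> * (C' * norm (\<Sum>k<N. b k *\<^sub>R e k))" by (rule mult_left_mono[OF sub]) auto
    finally show "norm (\<Sum>k<N. b k *\<^sub>R x (r k)) \<le> \<bar>C\<bar> * C' * norm (\<Sum>k<N. b k *\<^sub>R e k)" by simp
  qed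
qed

text \<open>Apply the bilinear estimate with \<open>c\<close> the coefficients of a vector in the
  unit ball: cut off at \<open>N\<close>, they give a combination of norm at most
  \<open>K\<close>.\<close>

lemma dominates_biorthI:
  assumes "\<And>N b c. (\<Sum>k<N. \<bar>b k * c k\<bar>) \<le> C * norm (\<Sum>k<N. b k *\<^sub>R e k) * norm (\<Sum>k<N. c k *\<^sub>R e k)"
  shows "dominates_biorth e"
  unfolding dominates_biorth_def
proof (intro exI[of _ "\<bar>C\<bar> * K"] allI)
  fix N and b :: "nat \<Rightarrow> real"
  let ?B = "norm (\<Sum>k<N. b k *\<^sub>R e k)"
  show "subspace_dual_norm (clspan e) (\<lambda>x. \<Sum>i<N. b i * biorth e i x) \<le> \<bar>C\<bar> * K * ?B"
    unfolding subspace_dual_norm_def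
  proof (rule cSup_least)
    have "0 \<in> clspan e" by (rule subspace_0[OF clspan_subspace])
    then show "{\<bar>\<Sum>i<N. b i * biorth e i x\<bar> |x. x \<in> clspan e \<and> norm x \<le> 1} \<noteq> {}" by force
    fix t assume "t \<in> {\<bar>\<Sum>i<N. b i * biorth e i x\<bar> |x. x \<in> clspan e \<and> norm x \<le> 1}"
    then obtain x where x: "x \<in> clspan e" "norm x \<le> 1" and t: "t = \<bar>\<Sum>i<N. b i * biorth e i x\<bar>" by blast
    have "norm (\<Sum>k<N. biorth e k x *\<^sub>R e k) \<le> K * norm x" by (rule projection_bound[OF x(1)]) simp
    also have "\<dots> \<le> K * 1" by (rule mult_left_mono) (use x(2) K_ge_1 in auto)
    finally have xK: "norm (\<Sum>k<N. biorth e k x *\<^sub>R e k) \<le> K" by simp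
    have "t \<le> (\<Sum>i<N. \<bar>b i * biorth e i x\<bar>)" unfolding t by (rule sum_abs)
    also have "\<dots> \<le> C * ?B * norm (\<Sum>k<N. biorth e k x *\<^sub>R e k)" by (rule assms)
    also have "\<dots> \<le> \<bar>C\<bar> * ?B * norm (\<Sum>k<N. biorth e k x *\<^sub>R e k)" by (intro mult_right_mono) auto
    also have "\<dots> \<le> \<bar>C\<bar> * ?B * K" by (rule mult_left_mono[OF xK]) auto
    finally show "t \<le> \<bar>C\<bar> * K * ?B" by (simp add: mult_ac)
  qed
qed

end

section \<open>Coordinate functionals, the sum functional and the gliding hump\<close>

context james_space
begin

definition coord :: "nat \<Rightarrow> 'j \<Rightarrow>\<^sub>L real" where
  "coord i = (SOME f. (\<forall>j. blinfun_apply f (u j) = (if i = j then 1 else 0)) \<and> (\<forall>x. \<bar>f x\<bar> \<le> K * norm x))"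

text \<open>On finite combinations this is the sum of the coefficients, the obstruction to
  approximation by zero-sum blocks.\<close>

definition total :: "'j \<Rightarrow>\<^sub>L real" where
  "total = (SOME f. (\<forall>j. blinfun_apply f (u j) = 1) \<and> (\<forall>x. \<bar>f x\<bar> \<le> norm x))"

lemma dense: "closure (span (range u)) = UNIV"
  using J_space by (simp add: is_J_space_def)

lemma coord_u: "coord i (u j) = (if i = j then 1 else 0)"
  and coord_bound: "\<bar>coord i x\<bar> \<le> K * norm x"
proof -
  let ?v = "\<lambda>j. if i = j then 1 else 0 :: real"
  have "norm (\<Sum>j<k. a j *\<^sub>R ?v j) \<le> K * norm (\<Sum>j<k. a j *\<^sub>R u j)" for k and a :: "nat \<Rightarrow> real"
  proof -
    have "norm (\<Sum>j<k. a j *\<^sub>R ?v j) \<le> K * norm (\<Sum>j<k. a j *\<^sub>R e j)"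
    proof (cases "i < k")
      case True
      have "(\<Sum>j<k. a j *\<^sub>R ?v j) = (\<Sum>j\<in>{i}. a j)"
        by (rule sum.mono_neutral_cong_right) (use True in auto)
      then show ?thesis using coefficient_bound[of "{..<k}" i a] True by simp
    next
      case False
      then have "(\<Sum>j<k. a j *\<^sub>R ?v j) = 0" by (intro sum.neutral) auto
      then show ?thesis using K_ge_1 by simp
    qed
    also have "\<dots> \<le> K * norm (\<Sum>j<k. a j *\<^sub>R u j)"
      by (rule mult_left_mono[OF norm_J_ge_basis]) (use K_ge_1 in simp)
    finally show ?thesis .
  qed
  then obtain f :: "'j \<Rightarrow>\<^sub>L real" where f: "\<And>j. f (u j) = ?v j" "\<And>x. norm (f x) \<le> K * norm x"
    by (rule extend_from_dense_span[OF dense]) blast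
  have "\<exists>f. (\<forall>j. blinfun_apply f (u j) = (if i = j then 1 else 0)) \<and> (\<forall>x. \<bar>f x\<bar> \<le> K * norm x)"
    using f by (intro exI[of _ f]) simp
  from someI_ex[OF this] show "coord i (u j) = (if i = j then 1 else 0)" "\<bar>coord i x\<bar> \<le> K * norm x"
    unfolding coord_def by auto
qed

lemma norm_J_ge_sum: "\<bar>\<Sum>i<N. a i\<bar> \<le> norm (\<Sum>i<N. a i *\<^sub>R u i)"
proof -
  define b where "b i = (if i < N then a i else 0)" for i
  have "\<forall>i\<ge>N. b i = 0" by (simp add: b_def)
  from norm_J_ge_initial_sum[OF this, of N] show ?thesis by (simp add: b_def)
qed

lemma total_u: "total (u j) = 1"
  and total_bound: "\<bar>total x\<bar> \<le> norm x"
proof -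
  have "norm (\<Sum>j<k. a j *\<^sub>R (1::real)) \<le> 1 * norm (\<Sum>j<k. a j *\<^sub>R u j)" for k a
    using norm_J_ge_sum[of a k] by simp
  then obtain f :: "'j \<Rightarrow>\<^sub>L real" where f: "\<And>j. f (u j) = 1" "\<And>x. norm (f x) \<le> 1 * norm x"
    by (rule extend_from_dense_span[OF dense]) blast
  have "\<exists>f. (\<forall>j. blinfun_apply f (u j) = 1) \<and> (\<forall>x. \<bar>f x\<bar> \<le> norm x)"
    using f by (intro exI[of _ f]) simp
  from someI_ex[OF this] show "total (u j) = 1" "\<bar>total x\<bar> \<le> norm x"
    unfolding total_def by auto
qed

lemma norm_combination_le: "finite G \<Longrightarrow> norm (\<Sum>i\<in>G. a i *\<^sub>R u i) \<le> (\<Sum>i\<in>G. \<bar>a i\<bar>)"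
proof (rule sum_norm_le)
  have "norm (u i) \<le> 1" for i
  proof -
    have "norm (\<Sum>j<Suc i. (if j = i then 1 else 0) *\<^sub>R u j) \<le> (\<Sum>j<Suc i. \<bar>if j = i then 1 else 0\<bar>)"
      by (rule norm_J_le_sum_abs) auto
    moreover have "(\<Sum>j<Suc i. (if j = i then 1 else 0) *\<^sub>R u j) = (\<Sum>j\<in>{i}. u j)"
      by (rule sum.mono_neutral_cong_right) auto
    moreover have "(\<Sum>j<Suc i. \<bar>if j = i then 1 else 0::real\<bar>) = (\<Sum>j\<in>{i}. 1)"
      by (rule sum.mono_neutral_cong_right) auto
    ultimately show ?thesis by simp
  qed
  then show "norm (a i *\<^sub>R u i) \<le> \<bar>a i\<bar>" for i by (simp add: mult_left_le)
qed

lemma norm_u: "norm (u i) \<le> 1"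
  using norm_combination_le[of "{i}" "\<lambda>_. 1"] by simp

lemma coord_sum: "finite G \<Longrightarrow> coord i (\<Sum>j\<in>G. a j *\<^sub>R u j) = (if i \<in> G then a i else 0)"
proof -
  assume G: "finite G"
  have "coord i (\<Sum>j\<in>G. a j *\<^sub>R u j) = (\<Sum>j\<in>G. a j * (if i = j then 1 else 0))"
    by (simp add: blinfun.sum_right blinfun.scaleR_right coord_u)
  also have "\<dots> = (\<Sum>j\<in>G. if i = j then a j else 0)" by (rule sum.cong) auto
  finally show ?thesis using G by simp
qed

lemma total_sum: "total (\<Sum>j\<in>G. a j *\<^sub>R u j) = (\<Sum>j\<in>G. a j)"
  by (simp add: blinfun.sum_right blinfun.scaleR_right total_u)

lemma finite_approximation:
  assumes "\<epsilon> > 0"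
  obtains N a where "N > P" "norm (x - (\<Sum>i<N. a i *\<^sub>R u i)) < \<epsilon>"
proof -
  have "x \<in> closure (span (range u))" using dense by simp
  then obtain y where y: "y \<in> span (range u)" "dist y x < \<epsilon>"
    unfolding closure_approachable using assms by blast
  have "\<exists>N a. P < N \<and> y = (\<Sum>i<N. a i *\<^sub>R u i)"
    using y(1)
  proof (induction rule: span_induct_alt)
    case base
    show ?case by (rule exI[of _ "Suc P"], rule exI[of _ "\<lambda>_. 0"]) simp
  next
    case (step c w y)
    then obtain j N a where w: "w = u j" and N: "P < N" "y = (\<Sum>i<N. a i *\<^sub>R u i)" by auto
    let ?a = "\<lambda>i. (if i < N then a i else 0) + (if i = j then c else 0)"
    let ?N = "max N (Suc j)"
    have 1: "(\<Sum>i<?N. (if i < N then a i else 0) *\<^sub>R u i) = (\<Sum>i<N. a i *\<^sub>R u i)"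
      by (rule sum.mono_neutral_cong_right) auto
    have 2: "(\<Sum>i<?N. (if i = j then c else 0) *\<^sub>R u i) = (\<Sum>i\<in>{j}. c *\<^sub>R u i)"
      by (rule sum.mono_neutral_cong_right) auto
    have "c *\<^sub>R w + y = (\<Sum>i<?N. ?a i *\<^sub>R u i)"
      using 1 2 by (simp add: w N(2) scaleR_left_distrib sum.distrib)
    then show ?case using N(1) by (intro exI[of _ ?N] exI[of _ ?a]) simp
  qed
  then obtain N a where "P < N" "y = (\<Sum>i<N. a i *\<^sub>R u i)" by blast
  then show thesis using y(2) by (intro that[of N a]) (auto simp: dist_norm norm_minus_commute)
qed

text \<open>A countable substitute for weak nullness, with just the functionals needed to delete an
  initial part and to balance the rest to sum 0.\<close>

definition coord_null :: "(nat \<Rightarrow> 'j) \<Rightarrow> bool" where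
  "coord_null z \<longleftrightarrow> (\<forall>i. (\<lambda>n. coord i (z n)) \<longlonglongrightarrow> 0) \<and> (\<lambda>n. total (z n)) \<longlonglongrightarrow> 0"

text \<open>An approximating finite combination is corrected twice: its first \<open>P\<close>
  coefficients, small since the coordinates tend to 0, are deleted, and the remaining sum
  \<open>\<tau>\<close>, small since \<open>total\<close> tends to 0, is subtracted at position
  \<open>P\<close>.\<close>

lemma zero_sum_approximation:
  assumes z: "coord_null z" and \<epsilon>: "\<epsilon> > 0"
  shows "\<exists>n Q a. n0 < n \<and> P < Q \<and> (\<Sum>i\<in>{P..<Q}. a i) = 0 \<and> norm (z n - (\<Sum>i\<in>{P..<Q}. a i *\<^sub>R u i)) \<le> \<epsilon>"
proof -
  \<comment> \<open>Approximating and deleting costs \<open>(1 + P * (1 + K)) * \<eta>\<close>,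
    balancing costs \<open>(2 + P * (1 + K)) * \<eta>\<close>; the denominator is the sum of both
    factors.\<close>
  define \<eta> where "\<eta> = \<epsilon> / (3 + 2 * (real P * (1 + K)))"
  have den: "3 + 2 * (real P * (1 + K)) > 0" using K_ge_1 by (intro add_pos_nonneg) auto
  have \<eta>: "\<eta> > 0" using \<epsilon> den by (simp add: \<eta>_def)
  have "\<forall>\<^sub>F n in sequentially. \<bar>coord i (z n)\<bar> < \<eta>" for i
    using z \<eta> unfolding coord_null_def by (auto dest!: spec[of _ i] tendstoD simp: dist_norm)
  then have "\<forall>\<^sub>F n in sequentially. \<forall>i\<in>{..<P}. \<bar>coord i (z n)\<bar> < \<eta>"
    by (simp add: eventually_ball_finite)
  moreover have "\<forall>\<^sub>F n in sequentially. \<bar>total (z n)\<bar> < \<eta>"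
    using z \<eta> unfolding coord_null_def by (auto dest!: tendstoD simp: dist_norm)
  moreover have "\<forall>\<^sub>F n in sequentially. n > n0" by (rule eventually_gt_at_top)
  ultimately have "\<forall>\<^sub>F n in sequentially. (\<forall>i\<in>{..<P}. \<bar>coord i (z n)\<bar> < \<eta>) \<and> \<bar>total (z n)\<bar> < \<eta> \<and> n > n0"
    by eventually_elim simp
  then obtain n where n: "\<And>i. i < P \<Longrightarrow> \<bar>coord i (z n)\<bar> < \<eta>" "\<bar>total (z n)\<bar> < \<eta>" "n > n0"
    unfolding eventually_sequentially by (meson lessThan_iff order_refl)
  obtain N a where N: "N > P" and a: "norm (z n - (\<Sum>i<N. a i *\<^sub>R u i)) < \<eta>"
    by (rule finite_approximation[OF \<eta>])
  let ?x = "\<Sum>i<N. a i *\<^sub>R u i" and ?x' = "\<Sum>i\<in>{P..<N}. a i *\<^sub>R u i" and ?h = "\<Sum>i<P. a i *\<^sub>R u i"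
  have x: "?x = ?h + ?x'"
    using sum_interval_diff[of P N "\<lambda>i. a i *\<^sub>R u i"] N by simp
  have ai: "\<bar>a i\<bar> \<le> (1 + K) * \<eta>" if "i < P" for i
  proof -
    have "\<bar>coord i (z n - ?x)\<bar> \<le> K * norm (z n - ?x)" by (rule coord_bound)
    also have "\<dots> \<le> K * \<eta>" using a K_ge_1 by (intro mult_left_mono) auto
    finally have "\<bar>coord i (z n) - a i\<bar> \<le> K * \<eta>" using that N by (simp add: blinfun.diff_right coord_sum)
    then show ?thesis using n(1)[OF that] by (simp add: algebra_simps abs_le_iff) linarith
  qed
  have "norm ?h \<le> (\<Sum>i<P. \<bar>a i\<bar>)" by (rule norm_combination_le) simp
  also have "\<dots> \<le> (\<Sum>i<P. (1 + K) * \<eta>)" by (rule sum_mono) (use ai in simp)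
  finally have h: "norm ?h \<le> real P * ((1 + K) * \<eta>)" by simp
  have zx': "norm (z n - ?x') \<le> \<eta> + real P * ((1 + K) * \<eta>)"
  proof -
    have eq: "z n - ?x' = (z n - ?x) + ?h" by (simp add: x)
    show ?thesis unfolding eq by (rule norm_triangle_mono[OF less_imp_le[OF a] h])
  qed
  define \<tau> where "\<tau> = (\<Sum>i\<in>{P..<N}. a i)"
  have "\<bar>total (z n - ?x')\<bar> \<le> norm (z n - ?x')" by (rule total_bound)
  then have \<tau>: "\<bar>\<tau>\<bar> \<le> 2 * \<eta> + real P * ((1 + K) * \<eta>)"
    using zx' n(2) by (simp add: blinfun.diff_right total_sum \<tau>_def abs_le_iff) linarith
  define a' where "a' i = a i - (if i = P then \<tau> else 0)" for i
  have single: "(\<Sum>i\<in>{P..<N}. (if i = P then \<tau> else 0) *\<^sub>R f i) = \<tau> *\<^sub>R f P" for f :: "nat \<Rightarrow> 'c::real_vector"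
  proof -
    have "(\<Sum>i\<in>{P..<N}. (if i = P then \<tau> else 0) *\<^sub>R f i) = (\<Sum>i\<in>{P}. \<tau> *\<^sub>R f i)"
      by (rule sum.mono_neutral_cong_right) (use N in auto)
    then show ?thesis by simp
  qed
  have "(\<Sum>i\<in>{P..<N}. a' i) = 0"
    using single[of "\<lambda>_. 1::real"] by (simp add: a'_def sum_subtractf \<tau>_def)
  moreover have "norm (z n - (\<Sum>i\<in>{P..<N}. a' i *\<^sub>R u i)) \<le> \<epsilon>"
  proof -
    have "z n - (\<Sum>i\<in>{P..<N}. a' i *\<^sub>R u i) = (z n - ?x') + \<tau> *\<^sub>R u P"
      by (simp add: a'_def scaleR_left_diff_distrib sum_subtractf single)
    also have "norm \<dots> \<le> (\<eta> + real P * ((1 + K) * \<eta>)) + (2 * \<eta> + real P * ((1 + K) * \<eta>))"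
    proof (rule norm_triangle_mono[OF zx'])
      have "norm (\<tau> *\<^sub>R u P) \<le> \<bar>\<tau>\<bar>" by (simp add: mult_left_le norm_u)
      then show "norm (\<tau> *\<^sub>R u P) \<le> 2 * \<eta> + real P * ((1 + K) * \<eta>)" using \<tau> by linarith
    qed
    also have "\<dots> = \<eta> * (3 + 2 * (real P * (1 + K)))" by (simp add: algebra_simps)
    also have "\<dots> = \<epsilon>" using den by (simp add: \<eta>_def)
    finally show ?thesis .
  qed
  ultimately show ?thesis using n(3) N by blast
qed

text \<open>Zero-sum blocks, each starting where the previous one ended, approximate
  \<open>z (r k)\<close> within \<open>(1/2)^k\<close>. The errors add at most \<open>2 * K\<close>
  to the domination constant, since every \<open>b k\<close> is at most \<open>K\<close> times the
  norm of the combination of \<open>e\<close>.\<close>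

lemma gliding_hump:
  assumes z: "coord_null z" and M: "\<And>n. norm (z n) \<le> M"
  obtains r where "strict_mono r" "dominates e (\<lambda>k. z (r k))"
proof -
  \<comment> \<open>A state consists of the start of the block, the index into \<open>z\<close>, the
    end of the block and the coefficients. The first start is pinned to 0 because
    \<open>zero_sum_block_estimate\<close> asks for \<open>p 0 = 0\<close>.\<close>
  define G where "G k s \<longleftrightarrow> (case s of (P, n, Q, a) \<Rightarrow> (k = 0 \<longrightarrow> P = 0) \<and> P < Q \<and> (\<Sum>i\<in>{P..<Q}. a i) = 0 \<and>
      norm (z n - (\<Sum>i\<in>{P..<Q}. a i *\<^sub>R u i)) \<le> (1/2)^k)" for k :: nat and s :: "nat \<times> nat \<times> nat \<times> (nat \<Rightarrow> real)"
  define H where "H s s' \<longleftrightarrow> (case s of (P, n, Q, a) \<Rightarrow> (case s' of (P', n', Q', a') \<Rightarrow> P' = Q \<and> n < n'))"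
    for s s' :: "nat \<times> nat \<times> nat \<times> (nat \<Rightarrow> real)"
  have "\<exists>f. \<forall>k. G k (f k) \<and> H (f k) (f (Suc k))"
  proof (rule dependent_nat_choice)
    show "\<exists>s. G 0 s"
      using zero_sum_approximation[OF z, of 1 0 0] by (auto simp: G_def)
    fix s k assume "G k s"
    obtain P n Q a where s: "s = (P, n, Q, a)" by (cases s)
    obtain n' Q' a' where "n < n'" "Q < Q'" "(\<Sum>i\<in>{Q..<Q'}. a' i) = 0"
      "norm (z n' - (\<Sum>i\<in>{Q..<Q'}. a' i *\<^sub>R u i)) \<le> (1/2)^Suc k"
      using zero_sum_approximation[OF z, of "(1/2)^Suc k" n Q] by auto
    then show "\<exists>s'. G (Suc k) s' \<and> H s s'"
      by (intro exI[of _ "(Q, n', Q', a')"]) (simp add: G_def H_def s)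
  qed
  then obtain f where f: "\<And>k. G k (f k)" "\<And>k. H (f k) (f (Suc k))" by blast
  define p where "p k = fst (f k)" for k
  define r where "r k = fst (snd (f k))" for k
  define A where "A k = snd (snd (snd (f k)))" for k
  have Q: "fst (snd (snd (f k))) = p (Suc k)" and r_less: "r k < r (Suc k)" for k
    using f(2)[of k] by (auto simp: H_def p_def r_def split: prod.splits)
  have fk: "f k = (p k, r k, p (Suc k), A k)" for k
    using Q[of k] by (simp add: p_def r_def A_def prod_eq_iff)
  have p0: "p 0 = 0" and p_less: "p k < p (Suc k)" and zero: "(\<Sum>i\<in>{p k..<p (Suc k)}. A k i) = 0"
    and close: "norm (z (r k) - (\<Sum>i\<in>{p k..<p (Suc k)}. A k i *\<^sub>R u i)) \<le> (1/2)^k" for k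
    using f(1)[of k] f(1)[of 0] by (simp_all add: G_def fk)
  have p: "strict_mono p" using p_less by (rule strict_monoI_Suc)
  have r: "strict_mono r" using r_less by (rule strict_monoI_Suc)
  define a where "a i = A (block_index p i) i" for i
  have a_eq: "(\<Sum>i\<in>{p k..<p (Suc k)}. a i *\<^sub>R g i) = (\<Sum>i\<in>{p k..<p (Suc k)}. A k i *\<^sub>R g i)"
    for k and g :: "nat \<Rightarrow> 'c::real_vector"
    by (rule sum.cong) (simp_all add: a_def block_index_eq[OF p, of k])
  let ?w = "\<lambda>k. \<Sum>i\<in>{p k..<p (Suc k)}. a i *\<^sub>R u i"
  have zero': "(\<Sum>i\<in>{p k..<p (Suc k)}. a i) = 0" for k
    using a_eq[of "\<lambda>_. 1::real" k] zero[of k] by simp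
  have close': "norm (z (r k) - ?w k) \<le> (1/2)^k" for k unfolding a_eq by (rule close)
  have w_bound: "norm (?w k) \<le> M + 1" for k
  proof -
    have "norm (?w k) \<le> norm (z (r k)) + norm (z (r k) - ?w k)"
      using norm_triangle_ineq4[of "z (r k)" "z (r k) - ?w k"] by simp
    also have "\<dots> \<le> M + (1/2)^k" by (rule add_mono[OF M close'])
    also have "\<dots> \<le> M + 1" by (simp add: power_le_one)
    finally show ?thesis .
  qed
  obtain C where C: "\<And>N b. norm (\<Sum>k<N. b k *\<^sub>R ?w k) \<le> C * norm (\<Sum>k<N. b k *\<^sub>R e k)"
    by (rule zero_sum_block_estimate[OF p p0 zero' w_bound]) blast
  have "dominates e (\<lambda>k. z (r k))" unfolding dominates_def
  proof (intro exI[of _ "C + 2 * K"] allI)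
    fix N and b :: "nat \<Rightarrow> real"
    let ?B = "norm (\<Sum>k<N. b k *\<^sub>R e k)"
    have eq: "(\<Sum>k<N. b k *\<^sub>R z (r k)) = (\<Sum>k<N. b k *\<^sub>R ?w k) + (\<Sum>k<N. b k *\<^sub>R (z (r k) - ?w k))"
      by (simp add: scaleR_diff_right flip: sum.distrib)
    have "norm (\<Sum>k<N. b k *\<^sub>R (z (r k) - ?w k)) \<le> (\<Sum>k<N. K * ?B * (1/2)^k)"
    proof (rule sum_norm_le)
      fix k assume k: "k \<in> {..<N}"
      have "\<bar>b k\<bar> \<le> K * ?B" by (rule coefficient_bound[OF _ k]) simp
      then have "\<bar>b k\<bar> * norm (z (r k) - ?w k) \<le> K * ?B * (1/2)^k"
        using close'[of k] by (intro mult_mono) (use K_ge_1 in auto)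
      then show "norm (b k *\<^sub>R (z (r k) - ?w k)) \<le> K * ?B * (1/2)^k" by simp
    qed
    also have "\<dots> = K * ?B * (\<Sum>k<N. (1/2)^k)" by (simp add: sum_distrib_left)
    also have "\<dots> \<le> K * ?B * 2"
    proof (rule mult_left_mono)
      show "(\<Sum>k<N. (1/2)^k) \<le> (2::real)" by (simp add: sum_gp_strict)
    qed (use K_ge_1 in simp)
    finally have rest: "norm (\<Sum>k<N. b k *\<^sub>R (z (r k) - ?w k)) \<le> K * ?B * 2" .
    show "norm (\<Sum>k<N. b k *\<^sub>R z (r k)) \<le> (C + 2 * K) * ?B"
      unfolding eq by (rule order_trans[OF norm_triangle_mono[OF C rest]]) (simp add: algebra_simps)
  qed
  then show thesis by (rule that[OF r])
qed

lemma coord_null_subsequence: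
  assumes "coord_null z" "strict_mono r"
  shows "coord_null (\<lambda>n. z (r n))"
  using assms LIMSEQ_subseq_LIMSEQ unfolding coord_null_def comp_def by blast

text \<open>Otherwise \<open>e\<close> dominates a sequence on which a bounded functional stays away from zero, which
  makes \<open>e\<close> equivalent to the unit vectors of \<open>l1\<close>.\<close>
lemma weakly_null:
  fixes f :: "nat \<Rightarrow> real"
  assumes nd: "\<not> dominates_biorth e" and z: "coord_null z" and M: "\<And>n. norm (z n) \<le> M"
    and L: "L \<ge> 0" "\<And>(N::nat) b r. \<bar>\<Sum>k<N. b k * f (r k)\<bar> \<le> L * norm (\<Sum>k<N. b k *\<^sub>R z (r k))"
  shows "f \<longlonglongrightarrow> 0"
proof (rule ccontr)
  assume "\<not> f \<longlonglongrightarrow> 0"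
  then obtain \<epsilon> where \<epsilon>: "\<epsilon> > 0" "\<forall>n0. \<exists>n\<ge>n0. \<epsilon> \<le> \<bar>f n\<bar>"
    unfolding LIMSEQ_def dist_real_def by (auto simp: not_less)
  then have "infinite {n. \<epsilon> \<le> \<bar>f n\<bar>}" by (simp add: infinite_nat_iff_unbounded_le)
  from infinite_enumerate[OF this] obtain g :: "nat \<Rightarrow> nat" where g: "strict_mono g" "\<forall>n. \<epsilon> \<le> \<bar>f (g n)\<bar>" by blast
  obtain r where r: "strict_mono r" "dominates e (\<lambda>k. z (g (r k)))"
    using gliding_hump[OF coord_null_subsequence[OF z g(1)], of M] M by blast
  then obtain C where C: "\<And>N b. norm (\<Sum>k<N. b k *\<^sub>R z (g (r k))) \<le> C * norm (\<Sum>k<N. b k *\<^sub>R e k)"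
    unfolding dominates_def by blast
  have l1: "(\<Sum>k<N. \<bar>b k\<bar>) \<le> (L * (\<bar>C\<bar> * (2 * K)) / \<epsilon>) * norm (\<Sum>k<N. b k *\<^sub>R e k)" for N b
  proof -
    \<comment> \<open>These signs make every term of the functional nonnegative;
      \<open>multiplier\<close> removes them again from the norm.\<close>
    define c where "c k = sgn (b k) * sgn (f (g (r k)))" for k
    have c: "\<bar>c k\<bar> \<le> 1" for k by (simp add: c_def abs_mult sgn_if)
    have "\<epsilon> * (\<Sum>k<N. \<bar>b k\<bar>) = (\<Sum>k<N. \<bar>b k\<bar> * \<epsilon>)" by (simp add: sum_distrib_left mult.commute)
    also have "\<dots> \<le> (\<Sum>k<N. \<bar>b k\<bar> * \<bar>f (g (r k))\<bar>)" by (intro sum_mono mult_left_mono g(2)[rule_format]) auto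
    also have "\<dots> = (\<Sum>k<N. (c k * b k) * f (g (r k)))"
      by (rule sum.cong) (simp_all add: c_def abs_sgn mult_ac)
    also have "\<dots> \<le> L * norm (\<Sum>k<N. (c k * b k) *\<^sub>R z (g (r k)))"
      using L(2)[of "\<lambda>k. c k * b k" "\<lambda>k. g (r k)" N] by linarith
    also have "\<dots> \<le> L * (\<bar>C\<bar> * (2 * K * 1 * norm (\<Sum>k<N. b k *\<^sub>R e k)))"
    proof (rule mult_left_mono[OF _ L(1)])
      have "norm (\<Sum>k<N. (c k * b k) *\<^sub>R z (g (r k))) \<le> C * norm (\<Sum>k<N. (c k * b k) *\<^sub>R e k)" by (rule C)
      also have "\<dots> \<le> \<bar>C\<bar> * norm (\<Sum>k<N. (c k * b k) *\<^sub>R e k)" by (rule mult_right_mono) auto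
      also have "\<dots> \<le> \<bar>C\<bar> * (2 * K * 1 * norm (\<Sum>k<N. b k *\<^sub>R e k))"
        by (intro mult_left_mono multiplier c) auto
      finally show "norm (\<Sum>k<N. (c k * b k) *\<^sub>R z (g (r k))) \<le> \<bar>C\<bar> * (2 * K * 1 * norm (\<Sum>k<N. b k *\<^sub>R e k))" .
    qed
    finally show ?thesis using \<epsilon>(1) by (simp add: field_simps)
  qed
  \<comment> \<open>Under an \<open>l1\<close> lower estimate for \<open>b\<close> it suffices that
    the coefficients \<open>c k\<close> are bounded.\<close>
  have "dominates_biorth e"
  proof (rule dominates_biorthI)
    fix N and b c :: "nat \<Rightarrow> real"
    let ?B = "norm (\<Sum>k<N. b k *\<^sub>R e k)" and ?C = "norm (\<Sum>k<N. c k *\<^sub>R e k)"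
    have "(\<Sum>k<N. \<bar>b k * c k\<bar>) \<le> (\<Sum>k<N. \<bar>b k\<bar> * (K * ?C))"
      unfolding abs_mult by (intro sum_mono mult_left_mono coefficient_bound) auto
    also have "\<dots> = (\<Sum>k<N. \<bar>b k\<bar>) * (K * ?C)" by (simp add: sum_distrib_right)
    also have "\<dots> \<le> (L * (\<bar>C\<bar> * (2 * K)) / \<epsilon>) * ?B * (K * ?C)"
      using K_ge_1 by (intro mult_right_mono l1) auto
    finally show "(\<Sum>k<N. \<bar>b k * c k\<bar>) \<le> (L * (\<bar>C\<bar> * (2 * K)) / \<epsilon> * K) * ?B * ?C"
      by (simp add: mult_ac)
  qed
  then show False using nd by simp
qed

end

section \<open>Compactness of operators\<close>

text \<open>Deterministic form of averaging over signs, in which the off-diagonal terms cancel: each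
  new sign is chosen so that its cross terms with the earlier ones add up to a nonnegative
  number.\<close>

lemma sign_selection:
  fixes A :: "nat \<Rightarrow> nat \<Rightarrow> real"
  shows "\<exists>s. (\<forall>k. \<bar>s k\<bar> \<le> (1::real)) \<and> (\<Sum>k<N. A k k) \<le> (\<Sum>k<N. \<Sum>l<N. s k * s l * A k l)"
proof (induction N)
  case 0
  show ?case by (rule exI[of _ "\<lambda>_. 0"]) simp
next
  case (Suc N)
  then obtain s where s: "\<forall>k. \<bar>s k\<bar> \<le> (1::real)" "(\<Sum>k<N. A k k) \<le> (\<Sum>k<N. \<Sum>l<N. s k * s l * A k l)" by blast
  define B where "B = (\<Sum>k<N. s k * (A k N + A N k))"
  define t where "t = (if B \<ge> 0 then 1 else -1 :: real)"
  define s' where "s' = s(N := t)"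
  have s'N: "s' N = t" and s': "k < N \<Longrightarrow> s' k = s k" for k by (auto simp: s'_def)
  have "(\<Sum>k<Suc N. \<Sum>l<Suc N. s' k * s' l * A k l) =
      (\<Sum>k<N. \<Sum>l<N. s k * s l * A k l) + (\<Sum>k<N. s k * t * A k N) + ((\<Sum>l<N. t * s l * A N l) + t * t * A N N)"
    by (simp add: s'N s' sum.distrib)
  also have "(\<Sum>k<N. s k * t * A k N) = t * (\<Sum>k<N. s k * A k N)"
    by (simp add: sum_distrib_left mult_ac)
  also have "(\<Sum>l<N. t * s l * A N l) = t * (\<Sum>k<N. s k * A N k)"
    by (simp add: sum_distrib_left mult_ac)
  finally have "(\<Sum>k<Suc N. \<Sum>l<Suc N. s' k * s' l * A k l) = (\<Sum>k<N. \<Sum>l<N. s k * s l * A k l) + t * B + t * t * A N N"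
    by (simp add: B_def distrib_left sum.distrib)
  moreover have "t * B \<ge> 0" "t * t = 1" by (auto simp: t_def)
  ultimately have "(\<Sum>k<Suc N. A k k) \<le> (\<Sum>k<Suc N. \<Sum>l<Suc N. s' k * s' l * A k l)"
    using s(2) by simp
  moreover have "\<forall>k. \<bar>s' k\<bar> \<le> 1" using s(1) by (simp add: s'_def t_def)
  ultimately show ?case by blast
qed

lemma convergent_diff_null:
  fixes f :: "nat \<Rightarrow> real"
  assumes "convergent f" "\<And>n. n \<le> p n" "\<And>n. n \<le> q n"
  shows "(\<lambda>n. f (p n) - f (q n)) \<longlonglongrightarrow> 0"
proof -
  obtain l where l: "f \<longlonglongrightarrow> l" using assms(1) by (auto simp: convergent_def)
  have p: "filterlim p at_top sequentially" and q: "filterlim q at_top sequentially"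
    using assms(2,3) by (auto intro: filterlim_at_top_mono[OF filterlim_ident])
  show ?thesis using tendsto_diff[OF filterlim_compose[OF l p] filterlim_compose[OF l q]] by simp
qed

lemma exists_norming_vector:
  fixes f :: "'j::real_normed_vector \<Rightarrow>\<^sub>L real"
  assumes "c < norm f" "0 \<le> c"
  obtains y where "norm y \<le> 1" "c < f y"
proof -
  have "\<exists>y. \<bar>f y\<bar> > c * norm y"
  proof (rule ccontr)
    assume "\<nexists>y. c * norm y < \<bar>blinfun_apply f y\<bar>"
    then have "norm f \<le> c" using assms(2) by (intro norm_blinfun_bound) (auto simp: not_less)
    then show False using assms(1) by simp
  qed
  then obtain y where y: "\<bar>f y\<bar> > c * norm y" by blast
  then have "y \<noteq> 0" by auto
  define w where "w = (sgn (f y) / norm y) *\<^sub>R y"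
  have "norm w \<le> 1" using \<open>y \<noteq> 0\<close> by (simp add: w_def sgn_if)
  moreover have "f w = \<bar>f y\<bar> / norm y" by (simp add: w_def blinfun.scaleR_right sgn_if)
  then have "c < f w" using y \<open>y \<noteq> 0\<close> by (simp add: pos_less_divide_eq)
  ultimately show thesis by (rule that)
qed

text \<open>The hypothesis is total boundedness of \<open>S\<close>; completeness of the space makes
  the closure compact.\<close>

lemma compact_closureI_Cauchy:
  fixes S :: "'b::banach set"
  assumes "\<And>\<sigma>. (\<And>n. \<sigma> n \<in> S) \<Longrightarrow> \<exists>r. strict_mono r \<and> Cauchy (\<lambda>n. \<sigma> (r n :: nat))"
  shows "compact (closure S)"
proof -
  have "Met_TC.mtotally_bounded S"
    unfolding Met_TC.mtotally_bounded_sequentially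
    using assms by (auto simp: comp_def image_subset_iff)
  then show ?thesis
    using Met_TC.mtotally_bounded_eq_compact_closure_of[of S] by (simp add: complete_UNIV)
qed

section \<open>The two directions of the equivalence\<close>

context james_space
begin

text \<open>Diagonal argument over the countable family of \<open>total\<close> and all
  \<open>coord i\<close>.\<close>

lemma coordinate_convergent_subsequence:
  assumes "\<And>n. norm (x n) \<le> M"
  obtains r :: "nat \<Rightarrow> nat" where "strict_mono r" "\<And>i. convergent (\<lambda>n. coord i (x (r n)))"
    "convergent (\<lambda>n. total (x (r n)))"
proof -
  let ?S = "insert total (range coord)"
  have "norm (blinfun_apply f (x n)) \<le> K * M" if "f \<in> ?S" for f n
  proof -
    have "\<bar>total (x n)\<bar> \<le> K * norm (x n)"
      using total_bound[of "x n"] mult_right_mono[OF K_ge_1 norm_ge_zero[of "x n"]] by linarith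
    then have "\<bar>f (x n)\<bar> \<le> K * norm (x n)" using that coord_bound by auto
    also have "\<dots> \<le> K * M" using assms K_ge_1 by (intro mult_left_mono) auto
    finally show ?thesis by simp
  qed
  note bound = this
  show thesis
  proof (rule function_convergent_subsequence[of ?S "\<lambda>n f. blinfun_apply f (x n)" "K * M"])
    show "countable ?S" by simp
    show "norm (blinfun_apply f (x n)) \<le> K * M" if "f \<in> ?S" for n f by (rule bound[OF that])
    fix r :: "nat \<Rightarrow> nat"
    assume r: "strict_mono r" and lim: "\<And>f. f \<in> ?S \<Longrightarrow> \<exists>l. (\<lambda>n. blinfun_apply f (x (r n))) \<longlonglongrightarrow> l"
    show thesis by (rule that[OF r]; unfold convergent_def; rule lim; simp)
  qed
qed

lemma coord_null_diff:
  assumes "\<And>i. convergent (\<lambda>n. coord i (x n))" "convergent (\<lambda>n. total (x n))"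
    "\<And>n. n \<le> p n" "\<And>n. n \<le> q n"
  shows "coord_null (\<lambda>n. x (p n) - x (q n))"
  unfolding coord_null_def blinfun.diff_right
  using convergent_diff_null[OF assms(1,3,4)] convergent_diff_null[OF assms(2,3,4)] by simp

lemma compact_operators:
  fixes T :: "'j \<Rightarrow> ('j \<Rightarrow>\<^sub>L real)"
  assumes nd: "\<not> dominates_biorth e" and E: "subspace E" and T: "bounded_linear_on E T"
  shows "compact_operator_on E T"
  unfolding compact_operator_on_def
proof (rule compact_closureI_Cauchy)
  obtain L0 where L0: "\<And>x. x \<in> E \<Longrightarrow> norm (T x) \<le> L0 * norm x"
    using T unfolding bounded_linear_on_def by blast
  define L where "L = \<bar>L0\<bar>"
  have L: "L \<ge> 0" "norm (T x) \<le> L * norm x" if "x \<in> E" for x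
    using L0[OF that] mult_right_mono[OF abs_ge_self[of L0] norm_ge_zero[of x]] by (auto simp: L_def)
  have L_nonneg: "L \<ge> 0" by (simp add: L_def)
  have T_add: "T (x + y) = T x + T y" if "x \<in> E" "y \<in> E" for x y
    using T that unfolding bounded_linear_on_def by blast
  have T_scale: "T (c *\<^sub>R x) = c *\<^sub>R T x" if "x \<in> E" for c x
    using T that unfolding bounded_linear_on_def by blast
  have T_diff: "T (x - y) = T x - T y" if "x \<in> E" "y \<in> E" for x y
    using T_add[OF that(1) subspace_mul[OF E that(2), of "-1"]] T_scale[OF that(2), of "-1"] by simp
  have T_0: "T 0 = 0" using T_scale[OF subspace_0[OF E], of 0] by simp
  have T_sum: "T (\<Sum>k<N. b k *\<^sub>R x k) = (\<Sum>k<N. b k *\<^sub>R T (x k))" if "\<And>k. x k \<in> E" for x b and N :: nat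
  proof (induction N)
    case (Suc N)
    have "(\<Sum>k<N. b k *\<^sub>R x k) \<in> E" by (intro subspace_sum subspace_mul E that)
    then show ?case using Suc T_add[OF _ subspace_mul[OF E that]] by (simp add: T_scale[OF that])
  qed (simp add: T_0)

  fix \<sigma> :: "nat \<Rightarrow> 'j \<Rightarrow>\<^sub>L real" assume \<sigma>: "\<And>n. \<sigma> n \<in> T ` (E \<inter> cball 0 1)"
  have "\<exists>x. x \<in> E \<and> norm x \<le> 1 \<and> \<sigma> n = T x" for n using \<sigma>[of n] by auto
  then obtain x where x: "\<And>n. x n \<in> E" "\<And>n. norm (x n) \<le> 1" "\<And>n. \<sigma> n = T (x n)" by metis
  obtain r where r: "strict_mono r" "\<And>i. convergent (\<lambda>n. coord i (x (r n)))" "convergent (\<lambda>n. total (x (r n)))"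
    by (rule coordinate_convergent_subsequence[of x 1, OF x(2)]) blast
  have "Cauchy (\<lambda>n. \<sigma> (r n))"
  proof (rule ccontr)
    assume "\<not> Cauchy (\<lambda>n. \<sigma> (r n))"
    then obtain \<delta> where \<delta>: "\<delta> > 0" "\<forall>N. \<exists>m\<ge>N. \<exists>n\<ge>N. \<delta> \<le> norm (\<sigma> (r m) - \<sigma> (r n))"
      unfolding Cauchy_def dist_norm by (auto simp: not_less)
    then obtain m n where mn: "\<And>N. m N \<ge> N" "\<And>N. n N \<ge> N" "\<And>N. \<delta> \<le> norm (\<sigma> (r (m N)) - \<sigma> (r (n N)))"
      by metis
    define z where "z N = x (r (m N)) - x (r (n N))" for N
    have zE: "z N \<in> E" for N unfolding z_def by (intro subspace_diff E x)
    have z_null: "coord_null z" unfolding z_def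
      by (rule coord_null_diff[where x = "\<lambda>n. x (r n)"]) (use r mn in auto)
    have z_norm: "norm (z N) \<le> 2" for N
      unfolding z_def using norm_triangle_le_diff[OF add_mono[OF x(2) x(2)], of "r (m N)" "r (n N)"] by simp
    have Tz: "\<delta> \<le> norm (T (z N))" for N
      using mn(3)[of N] by (simp add: z_def T_diff x)
    have "\<forall>N. \<exists>y. norm y \<le> 1 \<and> \<delta> / 2 < T (z N) y"
    proof
      fix N
      have "\<delta> / 2 < norm (T (z N))" using Tz[of N] \<delta>(1) by simp
      then show "\<exists>y. norm y \<le> 1 \<and> \<delta> / 2 < T (z N) y"
        by (rule exists_norming_vector) (use \<delta>(1) in auto)
    qed
    then obtain y where y: "\<And>N. norm (y N) \<le> 1" "\<And>N. \<delta> / 2 < T (z N) (y N)" by metis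
    obtain g where g: "strict_mono g" "\<And>i. convergent (\<lambda>n. coord i (y (g n)))" "convergent (\<lambda>n. total (y (g n)))"
      by (rule coordinate_convergent_subsequence[of y 1, OF y(1)]) blast
    define Z where "Z n = z (g n)" for n
    define Y where "Y n = y (g n)" for n
    have Z: "coord_null Z" "Z n \<in> E" "norm (Z n) \<le> 2" for n
      using coord_null_subsequence[OF z_null g(1)] zE z_norm by (simp_all add: Z_def[abs_def])
    have Y: "norm (Y n) \<le> 1" "\<delta> / 2 < T (Z n) (Y n)" for n using y by (simp_all add: Y_def Z_def)
    \<comment> \<open>Evaluation of \<open>T\<close> at \<open>Y k\<close> is a functional on
      \<open>E\<close> only. This is why \<open>weakly_null\<close> asks for an estimate on
      combinations of the sequence instead of a functional on all of J.\<close>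
    have T_null: "(\<lambda>n. T (Z n) (Y k)) \<longlonglongrightarrow> 0" for k
    proof (rule weakly_null[OF nd Z(1) Z(3) L_nonneg])
      fix N b and r :: "nat \<Rightarrow> nat"
      have "(\<Sum>i<N. b i * T (Z (r i)) (Y k)) = T (\<Sum>i<N. b i *\<^sub>R Z (r i)) (Y k)"
        by (simp add: T_sum[OF Z(2)] blinfun.sum_left blinfun.scaleR_left)
      also have "\<bar>\<dots>\<bar> \<le> norm (T (\<Sum>i<N. b i *\<^sub>R Z (r i))) * norm (Y k)"
        using norm_blinfun[of "T (\<Sum>i<N. b i *\<^sub>R Z (r i))" "Y k"] by simp
      also have "\<dots> \<le> norm (T (\<Sum>i<N. b i *\<^sub>R Z (r i))) * 1" by (rule mult_left_mono[OF Y(1)]) simp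
      also have "\<dots> \<le> L * norm (\<Sum>i<N. b i *\<^sub>R Z (r i))"
        using L(2)[OF subspace_sum[OF E subspace_mul[OF E Z(2)]]] by simp
      finally show "\<bar>\<Sum>i<N. b i * T (Z (r i)) (Y k)\<bar> \<le> L * norm (\<Sum>i<N. b i *\<^sub>R Z (r i))" .
    qed
    have "\<forall>k. \<exists>n. k \<le> n \<and> \<bar>T (Z n) (Y k)\<bar> < \<delta> / 4"
    proof
      fix k
      obtain n0 where "\<And>n. n \<ge> n0 \<Longrightarrow> norm (T (Z n) (Y k) - 0) < \<delta> / 4"
        using LIMSEQ_D[OF T_null, of "\<delta> / 4" k] \<delta>(1) by auto
      from this[of "max k n0"] show "\<exists>n. k \<le> n \<and> \<bar>T (Z n) (Y k)\<bar> < \<delta> / 4"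
        by (intro exI[of _ "max k n0"]) simp
    qed
    then obtain h where h: "\<And>k. k \<le> h k" "\<And>k. \<bar>T (Z (h k)) (Y k)\<bar> < \<delta> / 4" by metis
    define v where "v k = Z (h k)" for k
    \<comment> \<open>The subtraction makes the second sequence coordinate-null and costs at most
      \<open>\<delta> / 4\<close> of the pairing \<open>\<delta> / 2\<close>, by the choice of
      \<open>h\<close>.\<close>
    define d where "d k = Y (h k) - Y k" for k
    have hlim: "filterlim h at_top sequentially"
      using h(1) by (auto intro: filterlim_at_top_mono[OF filterlim_ident])
    have v_null: "coord_null v"
      using Z(1) filterlim_compose[OF _ hlim] unfolding coord_null_def v_def by blast
    have d_null: "coord_null d" unfolding d_def
      by (rule coord_null_diff) (use g h in \<open>auto simp: Y_def\<close>)
    have d_norm: "norm (d k) \<le> 2" for k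
      unfolding d_def using norm_triangle_le_diff[OF add_mono[OF Y(1) Y(1)], of "h k" k] by simp
    have vd: "\<delta> / 4 \<le> T (v k) (d k)" for k
      using Y(2)[of "h k"] h(2)[of k] by (simp add: v_def d_def blinfun.diff_right)
    have "norm (v k) \<le> 2" for k using Z(3) by (simp add: v_def)
    then obtain r1 where r1: "strict_mono r1" "dominates e (\<lambda>k. v (r1 k))"
      by (rule gliding_hump[OF v_null]) blast
    \<comment> \<open>The second extraction runs inside the first, so that both sequences share
      their indices; \<open>dominates_subsequence\<close> preserves the first domination.\<close>
    obtain r2 where r2: "strict_mono r2" "dominates e (\<lambda>k. d (r1 (r2 k)))"
      by (rule gliding_hump[OF coord_null_subsequence[OF d_null r1(1)] d_norm]) blast
    define V where "V k = v (r1 (r2 k))" for k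
    define W where "W k = d (r1 (r2 k))" for k
    have VE: "V k \<in> E" for k using Z(2) by (simp add: V_def v_def)
    have VW: "\<delta> / 4 \<le> T (V k) (W k)" for k using vd by (simp add: V_def W_def)
    obtain C1 where C1: "\<And>N b. norm (\<Sum>k<N. b k *\<^sub>R V k) \<le> C1 * norm (\<Sum>k<N. b k *\<^sub>R e k)"
      using dominates_subsequence[OF r1(2) r2(1)] unfolding dominates_def V_def by blast
    obtain C2 where C2: "\<And>N b. norm (\<Sum>k<N. b k *\<^sub>R W k) \<le> C2 * norm (\<Sum>k<N. b k *\<^sub>R e k)"
      using r2(2) unfolding dominates_def W_def by blast
    have signed: "norm (\<Sum>k<N. (s k * \<bar>b k\<bar>) *\<^sub>R X k) \<le> \<bar>C\<bar> * (2 * K) * norm (\<Sum>k<N. b k *\<^sub>R e k)"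
      if C: "\<And>N b. norm (\<Sum>k<N. b k *\<^sub>R X k) \<le> C * norm (\<Sum>k<N. b k *\<^sub>R e k)" and s: "\<forall>k. \<bar>s k\<bar> \<le> 1"
      for N and b s :: "nat \<Rightarrow> real" and X :: "nat \<Rightarrow> 'j" and C
    proof -
      have sb: "(s k * sgn (b k)) * b k = s k * \<bar>b k\<bar>" for k by (simp add: abs_sgn mult_ac)
      have "\<bar>s k * sgn (b k)\<bar> \<le> 1" for k using s by (simp add: abs_mult sgn_if)
      then have m: "norm (\<Sum>k<N. (s k * \<bar>b k\<bar>) *\<^sub>R e k) \<le> 2 * K * 1 * norm (\<Sum>k<N. b k *\<^sub>R e k)"
        using multiplier[of "{..<N}" "\<lambda>k. s k * sgn (b k)" 1 b] unfolding sb by simp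
      have "norm (\<Sum>k<N. (s k * \<bar>b k\<bar>) *\<^sub>R X k) \<le> C * norm (\<Sum>k<N. (s k * \<bar>b k\<bar>) *\<^sub>R e k)" by (rule C)
      also have "\<dots> \<le> \<bar>C\<bar> * norm (\<Sum>k<N. (s k * \<bar>b k\<bar>) *\<^sub>R e k)" by (rule mult_right_mono) auto
      also have "\<dots> \<le> \<bar>C\<bar> * (2 * K * 1 * norm (\<Sum>k<N. b k *\<^sub>R e k))" by (rule mult_left_mono[OF m]) simp
      finally show ?thesis by simp
    qed
    have "dominates_biorth e"
    proof (rule dominates_biorthI)
      fix N and b c :: "nat \<Rightarrow> real"
      let ?B = "norm (\<Sum>k<N. b k *\<^sub>R e k)" and ?C = "norm (\<Sum>k<N. c k *\<^sub>R e k)"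
      \<comment> \<open>Only the diagonal pairings are known to be large. The signs yield a double
        sum, hence a single value of \<open>T\<close>, that is at least the diagonal sum.\<close>
      obtain s where s: "\<forall>k. \<bar>s k\<bar> \<le> (1::real)"
        "(\<Sum>k<N. \<bar>b k\<bar> * \<bar>c k\<bar> * T (V k) (W k)) \<le> (\<Sum>k<N. \<Sum>l<N. s k * s l * (\<bar>b k\<bar> * \<bar>c l\<bar> * T (V k) (W l)))"
        using sign_selection[where N = N and A = "\<lambda>k l. \<bar>b k\<bar> * \<bar>c l\<bar> * T (V k) (W l)"] by blast
      let ?v = "\<Sum>k<N. (s k * \<bar>b k\<bar>) *\<^sub>R V k" and ?w = "\<Sum>l<N. (s l * \<bar>c l\<bar>) *\<^sub>R W l"
      have "(\<Sum>k<N. \<bar>b k * c k\<bar>) * (\<delta> / 4) = (\<Sum>k<N. \<bar>b k\<bar> * \<bar>c k\<bar> * (\<delta> / 4))"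
        by (simp add: sum_distrib_right abs_mult)
      also have "\<dots> \<le> (\<Sum>k<N. \<bar>b k\<bar> * \<bar>c k\<bar> * T (V k) (W k))"
        by (intro sum_mono mult_left_mono VW) auto
      also have "\<dots> \<le> (\<Sum>k<N. \<Sum>l<N. s k * s l * (\<bar>b k\<bar> * \<bar>c l\<bar> * T (V k) (W l)))" by (rule s(2))
      also have "\<dots> = (\<Sum>k<N. (s k * \<bar>b k\<bar>) * T (V k) ?w)"
        by (simp add: blinfun.sum_right blinfun.scaleR_right sum_distrib_left mult_ac)
      also have "\<dots> = T ?v ?w"
        unfolding T_sum[OF VE] blinfun.sum_left blinfun.scaleR_left by simp
      also have "\<dots> \<le> norm (T ?v) * norm ?w"
        using norm_blinfun[of "T ?v" ?w] by simp
      also have "\<dots> \<le> (L * norm ?v) * norm ?w"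
        by (intro mult_right_mono L(2) subspace_sum[OF E] subspace_mul[OF E] VE) auto
      also have "\<dots> \<le> (L * (\<bar>C1\<bar> * (2 * K) * ?B)) * (\<bar>C2\<bar> * (2 * K) * ?C)"
        by (intro mult_mono mult_left_mono signed[OF C1 s(1)] signed[OF C2 s(1)])
          (use L_nonneg K_ge_1 in auto)
      finally have "(\<Sum>k<N. \<bar>b k * c k\<bar>) \<le> (L * (\<bar>C1\<bar> * (2 * K) * ?B)) * (\<bar>C2\<bar> * (2 * K) * ?C) / (\<delta> / 4)"
        using \<delta>(1) by (simp add: pos_le_divide_eq)
      then show "(\<Sum>k<N. \<bar>b k * c k\<bar>) \<le> (L * (\<bar>C1\<bar> * (2 * K)) * (\<bar>C2\<bar> * (2 * K)) / (\<delta> / 4)) * ?B * ?C"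
        by (simp add: mult_ac)
    qed
    then show False using nd by simp
  qed
  then show "\<exists>r. strict_mono r \<and> Cauchy (\<lambda>n. \<sigma> (r n :: nat))" using r(1) by blast
qed

text \<open>On finite combinations \<open>coord i\<close> acts as \<open>biorth e i\<close> does on
  the same combination of \<open>e\<close>. Domination of \<open>e\<close> by \<open>u\<close> is
  then used twice, for the coefficients \<open>a\<close> and for the argument.\<close>

lemma noncompact_operator:
  assumes dom: "dominates_biorth e"
  obtains T :: "'j \<Rightarrow> ('j \<Rightarrow>\<^sub>L real)" where "bounded_linear_on UNIV T" "\<not> compact_operator_on UNIV T"
proof -
  obtain C where C: "\<And>k a. subspace_dual_norm (clspan e) (\<lambda>x. \<Sum>i<k. a i * biorth e i x) \<le> C * norm (\<Sum>i<k. a i *\<^sub>R e i)"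
    using dom unfolding dominates_biorth_def by blast
  \<comment> \<open>The dual norm is a bare \<open>Sup\<close> over the unit ball: boundedness of
    the set makes it an upper bound, and normalizing \<open>x\<close> gives the homogeneous
    estimate.\<close>
  have functional: "\<bar>\<Sum>i<k. a i * biorth e i x\<bar> \<le> C * norm (\<Sum>i<k. a i *\<^sub>R e i) * norm x"
    if x: "x \<in> clspan e" for k a x
  proof (cases "x = 0")
    case True
    have "biorth e i 0 = 0" for i using biorth_finite_combination[OF basic, of "{}" i] by simp
    then show ?thesis using True by simp
  next
    case False
    let ?f = "\<lambda>x. \<Sum>i<k. a i * biorth e i x"
    have coef: "\<bar>biorth e i y\<bar> \<le> K * norm y" if "y \<in> clspan e" for i y
      using projection_bound[OF that, of "{i}"] by (simp add: norm_e)
    have bdd: "bdd_above {\<bar>?f y\<bar> |y. y \<in> clspan e \<and> norm y \<le> 1}"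
    proof (rule bdd_aboveI)
      fix t assume "t \<in> {\<bar>?f y\<bar> |y. y \<in> clspan e \<and> norm y \<le> 1}"
      then obtain y where y: "t = \<bar>?f y\<bar>" "y \<in> clspan e" "norm y \<le> 1" by blast
      have "\<bar>biorth e i y\<bar> \<le> K" for i
      proof -
        have "K * norm y \<le> K * 1" by (rule mult_left_mono[OF y(3)]) (use K_ge_1 in simp)
        then show ?thesis using coef[OF y(2), of i] by linarith
      qed
      then have "(\<Sum>i<k. \<bar>a i * biorth e i y\<bar>) \<le> (\<Sum>i<k. \<bar>a i\<bar> * K)"
        unfolding abs_mult by (intro sum_mono mult_left_mono) auto
      then show "t \<le> (\<Sum>i<k. \<bar>a i\<bar> * K)" unfolding y(1) by (rule order_trans[OF sum_abs])
    qed
    define y where "y = (1 / norm x) *\<^sub>R x"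
    have y: "y \<in> clspan e" "norm y \<le> 1" using x False by (simp_all add: y_def subspace_mul[OF clspan_subspace])
    have "biorth e i y = biorth e i x / norm x" for i
    proof -
      have "\<exists>!a::nat \<Rightarrow> real. (\<lambda>n. \<Sum>i<n. a i *\<^sub>R e i) \<longlonglongrightarrow> x" using basic x unfolding basic_seq_def by (rule bspec)
      then obtain a :: "nat \<Rightarrow> real" where a: "(\<lambda>n. \<Sum>i<n. a i *\<^sub>R e i) \<longlonglongrightarrow> x" by (rule ex1E)
      have "(\<lambda>n. (1 / norm x) *\<^sub>R (\<Sum>i<n. a i *\<^sub>R e i)) \<longlonglongrightarrow> y"
        unfolding y_def by (intro tendsto_intros a)
      then have "(\<lambda>n. \<Sum>i<n. (1 / norm x * a i) *\<^sub>R e i) \<longlonglongrightarrow> y"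
        by (simp add: scaleR_right.sum)
      from biorth_eqI[OF basic y(1) this] biorth_eqI[OF basic x a] show ?thesis by simp
    qed
    then have fy: "?f y = ?f x / norm x" by (simp add: sum_divide_distrib)
    have "\<bar>?f y\<bar> \<le> subspace_dual_norm (clspan e) ?f"
      unfolding subspace_dual_norm_def by (rule cSup_upper[OF _ bdd]) (use y in blast)
    also have "\<dots> \<le> C * norm (\<Sum>i<k. a i *\<^sub>R e i)" by (rule C)
    finally show ?thesis using False by (simp add: fy field_simps)
  qed
  have "norm (\<Sum>i<k. a i *\<^sub>R coord i) \<le> \<bar>C\<bar> * norm (\<Sum>i<k. a i *\<^sub>R u i)" for k a
  proof (rule norm_blinfun_bound)
    show "0 \<le> \<bar>C\<bar> * norm (\<Sum>i<k. a i *\<^sub>R u i)" by simp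
    let ?f = "\<Sum>i<k. a i *\<^sub>R coord i" and ?A = "\<bar>C\<bar> * norm (\<Sum>i<k. a i *\<^sub>R u i)"
    have on_span: "norm (?f (\<Sum>j<N. c j *\<^sub>R u j)) \<le> ?A * norm (\<Sum>j<N. c j *\<^sub>R u j)" for N c
    proof -
      let ?x = "\<Sum>j<N. c j *\<^sub>R e j"
      have "?f (\<Sum>j<N. c j *\<^sub>R u j) = (\<Sum>i<k. a i * biorth e i ?x)"
        by (simp add: blinfun.sum_left blinfun.scaleR_left coord_sum biorth_finite_combination[OF basic])
      also have "\<bar>\<dots>\<bar> \<le> C * norm (\<Sum>i<k. a i *\<^sub>R e i) * norm ?x"
        by (rule functional[OF finite_combination_clspan])
      also have "\<dots> \<le> \<bar>C\<bar> * norm (\<Sum>i<k. a i *\<^sub>R e i) * norm ?x" by (intro mult_right_mono) auto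
      also have "\<dots> \<le> ?A * norm (\<Sum>j<N. c j *\<^sub>R u j)"
        by (intro mult_mono mult_left_mono norm_J_ge_basis) auto
      finally show ?thesis by simp
    qed
    fix y
    show "norm (?f y) \<le> ?A * norm y"
    proof (rule field_le_epsilon)
      fix \<epsilon> :: real assume \<epsilon>: "0 < \<epsilon>"
      define \<eta> where "\<eta> = \<epsilon> / (norm ?f + ?A + 1)"
      have den: "norm ?f + ?A + 1 > 0" by (simp add: add_nonneg_pos)
      have \<eta>: "\<eta> > 0" using \<epsilon> den by (simp add: \<eta>_def)
      obtain N c where c: "norm (y - (\<Sum>i<N. c i *\<^sub>R u i)) < \<eta>"
        by (rule finite_approximation[OF \<eta>])
      let ?x = "\<Sum>i<N. c i *\<^sub>R u i"
      have "norm (?f y) \<le> norm (?f (y - ?x)) + norm (?f ?x)"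
        using norm_triangle_ineq[of "?f (y - ?x)" "?f ?x"] by (simp add: blinfun.diff_right)
      also have "\<dots> \<le> norm ?f * \<eta> + ?A * (norm y + \<eta>)"
      proof (rule add_mono)
        show "norm (?f (y - ?x)) \<le> norm ?f * \<eta>"
          by (rule order_trans[OF norm_blinfun mult_left_mono]) (use c in auto)
        have "norm ?x \<le> norm y + \<eta>" using c norm_triangle_ineq3[of ?x y] by (simp add: norm_minus_commute)
        then have "?A * norm ?x \<le> ?A * (norm y + \<eta>)" by (rule mult_left_mono) simp
        then show "norm (?f ?x) \<le> ?A * (norm y + \<eta>)" by (rule order_trans[OF on_span])
      qed
      also have "\<dots> \<le> ?A * norm y + \<eta> * (norm ?f + ?A + 1)" using \<eta> by (simp add: algebra_simps)
      also have "\<eta> * (norm ?f + ?A + 1) = \<epsilon>" using den by (simp add: \<eta>_def)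
      finally show "norm (?f y) \<le> ?A * norm y + \<epsilon>" .
    qed
  qed
  then obtain S :: "'j \<Rightarrow>\<^sub>L ('j \<Rightarrow>\<^sub>L real)" where S: "\<And>i. S (u i) = coord i"
    by (rule extend_from_dense_span[OF dense]) blast
  have "bounded_linear_on UNIV (blinfun_apply S)" unfolding bounded_linear_on_def
    using norm_blinfun[of S] by (auto simp: blinfun.add_right blinfun.scaleR_right)
  moreover have "\<not> compact_operator_on UNIV (blinfun_apply S)"
  proof
    assume "compact_operator_on UNIV (blinfun_apply S)"
    then have "seq_compact (closure (blinfun_apply S ` cball 0 1))"
      by (simp add: compact_operator_on_def compact_eq_seq_compact_metric)
    moreover have "\<forall>n. coord n \<in> closure (blinfun_apply S ` cball 0 1)"
    proof
      fix n
      have "u n \<in> cball 0 1" using norm_u[of n] by simp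
      then have "S (u n) \<in> blinfun_apply S ` cball 0 1" by (rule imageI)
      then show "coord n \<in> closure (blinfun_apply S ` cball 0 1)"
        unfolding S by (rule subsetD[OF closure_subset])
    qed
    ultimately obtain l r where r: "strict_mono r" "(\<lambda>n. coord (r n)) \<longlonglongrightarrow> l"
      unfolding seq_compact_def comp_def by blast
    then have "Cauchy (\<lambda>n. coord (r n))" by (intro LIMSEQ_imp_Cauchy)
    then obtain N where N: "\<forall>m\<ge>N. \<forall>n\<ge>N. norm (coord (r m) - coord (r n)) < 1"
      using CauchyD[of "\<lambda>n. coord (r n)" 1] by auto
    \<comment> \<open>Distinct coordinate functionals differ by 1 at a vector \<open>u (r N)\<close>
      of norm at most 1, so no subsequence of them is Cauchy.\<close>
    have "r N \<noteq> r (Suc N)" using strict_mono_Suc_iff r(1) by (metis less_irrefl)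
    then have "1 = \<bar>(coord (r N) - coord (r (Suc N))) (u (r N))\<bar>"
      by (simp add: blinfun.diff_left coord_u)
    also have "\<dots> \<le> norm (coord (r N) - coord (r (Suc N))) * norm (u (r N))"
      using norm_blinfun[of "coord (r N) - coord (r (Suc N))" "u (r N)"] by simp
    also have "\<dots> \<le> norm (coord (r N) - coord (r (Suc N))) * 1" by (rule mult_left_mono[OF norm_u]) simp
    also have "\<dots> < 1" using N[rule_format, of N "Suc N"] by simp
    finally show False by simp
  qed
  ultimately show thesis by (rule that)
qed

end

theorem theorem3:
  fixes e :: "nat \<Rightarrow> 'a::banach" and u :: "nat \<Rightarrow> 'j::banach"
  assumes normalized: "\<forall>i. norm (e i) = 1"
    and rd: "right_dominant e"
    and blocks: "\<forall>y. normalized_block_basis e y \<longrightarrow> dominates e y"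
    and J: "is_J_space e u"
  shows "(\<forall>(E::'j set) (T::'j \<Rightarrow> ('j \<Rightarrow>\<^sub>L real)).
            closed E \<and> subspace E \<and> bounded_linear_on E T \<longrightarrow> compact_operator_on E T)
         \<longleftrightarrow> \<not> dominates_biorth e"
proof -
  have unc: "unconditional_basic e" using rd by (simp add: right_dominant_def)
  obtain K where K: "K \<ge> 1"
    "\<And>x F. x \<in> clspan e \<Longrightarrow> finite F \<Longrightarrow> norm (\<Sum>i\<in>F. biorth e i x *\<^sub>R e i) \<le> K * norm x"
    by (rule biorth_bound[OF unc]) blast
  obtain D where D: "\<And>m n k b. \<forall>i. m i \<le> n i \<and> n i < m (Suc i) \<Longrightarrow>
      norm (\<Sum>i<k. b i *\<^sub>R e (m i)) \<le> D * norm (\<Sum>i<k. b i *\<^sub>R e (n i))"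
    using rd unfolding right_dominant_def by blast
  \<comment> \<open>The definition of right dominance leaves the sign of \<open>D\<close> open,
    while the locale wants a nonnegative constant.\<close>
  interpret james_space e K "\<bar>D\<bar>" u
  proof
    fix m n :: "nat \<Rightarrow> nat" and k and b :: "nat \<Rightarrow> real"
    assume "\<And>i. m i \<le> n i \<and> n i < m (Suc i)"
    then have "norm (\<Sum>i<k. b i *\<^sub>R e (m i)) \<le> D * norm (\<Sum>i<k. b i *\<^sub>R e (n i))" by (intro D allI)
    also have "\<dots> \<le> \<bar>D\<bar> * norm (\<Sum>i<k. b i *\<^sub>R e (n i))" by (rule mult_right_mono) auto
    finally show "norm (\<Sum>i<k. b i *\<^sub>R e (m i)) \<le> \<bar>D\<bar> * norm (\<Sum>i<k. b i *\<^sub>R e (n i))" .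
  qed (use normalized unc K blocks J in \<open>simp_all add: unconditional_basic_def\<close>)
  show ?thesis
  proof
    assume a: "\<forall>(E::'j set) (T::'j \<Rightarrow> ('j \<Rightarrow>\<^sub>L real)).
      closed E \<and> subspace E \<and> bounded_linear_on E T \<longrightarrow> compact_operator_on E T"
    show "\<not> dominates_biorth e"
    proof
      assume "dominates_biorth e"
      then obtain T :: "'j \<Rightarrow> ('j \<Rightarrow>\<^sub>L real)" where "bounded_linear_on UNIV T" "\<not> compact_operator_on UNIV T"
        by (rule noncompact_operator)
      then show False using a by simp
    qed
  qed (use compact_operators in blast)
qed

end
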